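(* Let $d\ge 1$, $b\in\mathbb{S}^{d-1}$ and $0<\alpha<1$. Let $u:\mathbb{R}^d\times\mathbb{R}_+\to\mathbb{R}$ be such that $u(\cdot,t)\in\mathcal{S}(\mathbb{R}^d)$ for all $t\in\mathbb{R}_+$, and suppose there are constants $M>0$ and $a\in\mathbb{R}$ with $$\|u(\cdot,t)\|_\infty\le M e^{at},\qquad t\ge 0.$$ Then the fractional material integral $I_b^\alpha u$ (defined through its Fourier-Laplace transform) has the pointwise representation $$I_b^{\alpha}u(x,t)=\frac{1}{\Gamma(\alpha)}\int_0^t (t-s)^{\alpha-1}\,u\bigl(x-b(t-s),s\bigr)\,ds .$$
   Context: $\mathbb{R}_+=[0,\infty)$; $\mathbb{S}^{d-1}=\{x\in\mathbb{R}^d:\|x\|=1\}$; $\mathcal{S}(\mathbb{R}^d)$ is the Schwartz space. The Fourier-Laplace transform of a function $u(x,t)$ on $\mathbb{R}^d\times[0,\infty)$ is $\mathcal{FL}\{u\}(\xi,s)=\int_0^\infty e^{-st}\int_{\mathbb{R}^d}e^{i\xi\cdot x}u(x,t)\,dx\,dt$ (for $\Re s$ sufficiently large). The fractional material derivative of order $\alpha$ in direction $b$ is the operator with Fourier-Laplace multiplier $(s-ib\cdot\xi)^{\alpha}$ (principal branch). The fractional material integral $I_b^\alpha$ is its inverse operator, i.e. $I_b^\alpha u$ is the object whose Fourier-Laplace transform is $$\mathcal{FL}\{I_b^\alpha u\}(\xi,s)=(s-ib\cdot\xi)^{-\alpha}\,\mathcal{FL}\{u\}(\xi,s).$$ The definition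 presupposes that the Fourier-Laplace transform of $u$ makes sense. *)

theory Defs
  imports "HOL-Analysis.Analysis"
begin

definition partial_deriv :: "'a::euclidean_space \<Rightarrow> ('a \<Rightarrow> real) \<Rightarrow> 'a \<Rightarrow> real" where
  "partial_deriv i f x = frechet_derivative f (at x) i"

(* A list of basis vectors plays the role of the multi-index of differentiation. *)
definition iterated_partial_deriv ::
  "'a::euclidean_space list \<Rightarrow> ('a \<Rightarrow> real) \<Rightarrow> 'a \<Rightarrow> real" where
  "iterated_partial_deriv is f = foldr partial_deriv is f"

(* Differentiability of every iterated partial derivative is the same as C^infinity: it makes all
   of them exist and be continuous, and conversely continuous partial derivatives give
   differentiability. *)
definition schwartz_space :: "('a::euclidean_space \<Rightarrow> real) set" where
  "schwartz_space = {f. \<forall>is. set is \<subseteq> Basis \<longrightarrow>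
     (\<forall>x. iterated_partial_deriv is f differentiable at x) \<and>
     (\<forall>k :: 'a \<Rightarrow> nat.
        bounded (range (\<lambda>x. (\<Prod>i\<in>Basis. (x \<bullet> i) ^ k i) * iterated_partial_deriv is f x)))}"

definition fourier_laplace ::
  "('a::euclidean_space \<Rightarrow> real \<Rightarrow> complex) \<Rightarrow> 'a \<Rightarrow> complex \<Rightarrow> complex" where
  "fourier_laplace u \<xi> s =
     (LINT t:{0..}|lebesgue. exp (- s * of_real t) *
        (LINT x|lebesgue. exp (\<i> * of_real (\<xi> \<bullet> x)) * u x t))"

(* Since norm (exp (- s * t) * exp (i * (xi . x)) * u x t) = exp (- Re s * t) * norm (u x t), this
   is absolute convergence of the double integral for Re s = sigma (equivalently, for every s with
   Re s >= sigma) and every frequency xi. *)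
definition fourier_laplace_converges ::
  "('a::euclidean_space \<Rightarrow> real \<Rightarrow> complex) \<Rightarrow> real \<Rightarrow> bool" where
  "fourier_laplace_converges u \<sigma> \<longleftrightarrow>
     (\<lambda>(x, t). of_real (exp (- \<sigma> * t)) * u x t) absolutely_integrable_on (UNIV \<times> {0..})"

(* "w is the fractional material integral of u". It is a relation because a Fourier-Laplace
   transform determines a function only up to null sets. The existential over sigma expresses
   "for Re s sufficiently large"; powr on complex is the principal branch. *)
definition is_fractional_material_integral ::
  "real \<Rightarrow> 'a::euclidean_space \<Rightarrow> ('a \<Rightarrow> real \<Rightarrow> complex) \<Rightarrow> ('a \<Rightarrow> real \<Rightarrow> complex) \<Rightarrow> bool" where
  "is_fractional_material_integral \<alpha> b u w \<longleftrightarrow>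
     (\<exists>\<sigma>. fourier_laplace_converges u \<sigma> \<and> fourier_laplace_converges w \<sigma> \<and>
        (\<forall>\<xi> s. Re s > \<sigma> \<longrightarrow>
           fourier_laplace w \<xi> s =
             (s - \<i> * of_real (b \<bullet> \<xi>)) powr (- of_real \<alpha>) * fourier_laplace u \<xi> s))"

end

theory Submission
  imports Defs "HOL-Probability.Levy"
begin

text \<open>
  The material integral is a convolution in space-time. Extend \<open>u\<close> by zero to negative times and put
  \<open>c = (b, 1)\<close>. The substitution \<open>\<tau> = t - s\<close> turns the right-hand side of the representation into
  \<open>1 / \<Gamma>(\<alpha>)\<close> times \<open>V p = \<integral> k(\<tau>) u(p - \<tau> c) d\<tau>\<close>, where \<open>k(\<tau>) = \<tau>\<^sup>\<alpha>\<^sup>-\<^sup>1\<close> for \<open>\<tau> > 0\<close>: the function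
  \<open>u\<close> is averaged along the line in direction \<open>c\<close> through the space-time point \<open>p = (x, t)\<close>. The kernel
  \<open>exp (\<i> \<xi> \<bullet> x - s t)\<close> of the Fourier-Laplace transform is multiplicative in \<open>p\<close>, so Fubini and
  translation invariance show that the transform of \<open>V\<close> is the transform of \<open>u\<close> times the integral of \<open>k\<close>
  against the kernel along that line. This integral is the Laplace transform of \<open>k\<close> at
  \<open>z = s - \<i> b \<bullet> \<xi>\<close>, which equals \<open>\<Gamma>(\<alpha>) z\<^sup>-\<^sup>\<alpha>\<close>. The lemmas are
  \<open>character_integral_line_convolution\<close> and \<open>laplace_rl_kernel\<close>. The growth bound on \<open>u\<close> makes the line integrals
  converge absolutely at every point, not just at almost every point.

  For the uniqueness part, take the difference of two functions with the same transform and damp it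
  by \<open>exp (- \<rho> t)\<close>. The result is integrable on space-time, and its Fourier transform vanishes, because its values
  are those of the Fourier-Laplace transform on the line \<open>Re s = \<rho>\<close>
  (\<open>fourier_laplace_inject_AE\<close>). An integrable function with vanishing Fourier transform is zero almost everywhere
  (\<open>AE_eq_0_if_fourier_transform_eq_0\<close>); this is reduced to the uniqueness of characteristic functions on the
  real line by treating one coordinate after the other. The function \<open>V\<close> is continuous although \<open>u\<close> is merely
  measurable in time, because the integration over the past smooths in time
  (\<open>continuous_rl_transport\<close>); so a continuous material integral agrees with it at every point.

  Two measure-theoretic points need care. No regularity of \<open>u\<close> in time is assumed; only
  the convergence of the transform makes \<open>u\<close> jointly Lebesgue measurable. Since \<open>u\<close> is continuous in space, one
  null set of times suffices to make it Borel (\<open>ex_borel_modification\<close>), so the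
  integrals along lines in direction \<open>c\<close> make sense and are unaffected by the modification. And the transform is an iterated integral, which is identified
  with an integral over space-time in \<open>fourier_laplace_eq_set_integral\<close>.
\<close>

section \<open>Uniqueness of the Fourier transform of integrable functions\<close>

text \<open>If the positive and the negative part of \<open>G\<close>, normalised to densities of probability measures, are pushed forward along
  \<open>X\<close>, the hypothesis says that the two laws have the same characteristic function. Levy's theorem makes
  them equal.\<close>
lemma integral_indicator_vimage_eq_0_real:
  fixes G X :: "'b \<Rightarrow> real"
  assumes G: "integrable M G" and X [measurable]: "X \<in> borel_measurable M"
    and zero: "\<And>\<eta>. (\<integral>p. of_real (G p) * iexp (\<eta> * X p) \<partial>M) = 0"
    and A [measurable]: "A \<in> sets borel"
  shows "(\<integral>p. G p * indicator A (X p) \<partial>M) = 0"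
proof -
  have [measurable]: "G \<in> borel_measurable M"
    using G by auto
  define P N where "P p = max 0 (G p)" and "N p = max 0 (- G p)" for p
  have [measurable]: "P \<in> borel_measurable M" "N \<in> borel_measurable M"
    unfolding P_def[abs_def] N_def[abs_def] by measurable
  have nn: "0 \<le> P p" "0 \<le> N p" and G_eq: "G p = P p - N p" for p
    by (auto simp: P_def N_def)
  have P: "integrable M P" and N: "integrable M N"
    unfolding P_def[abs_def] N_def[abs_def] using G by auto
  have int_iexp: "integrable M (\<lambda>p. complex_of_real (Q p) * iexp (\<eta> * X p))"
    if Q: "integrable M Q" for Q \<eta>
  proof (rule Bochner_Integration.integrable_bound[OF Q])
    show "(\<lambda>p. complex_of_real (Q p) * iexp (\<eta> * X p)) \<in> borel_measurable M"
      using Q by measurable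
  qed (simp add: norm_mult)
  have PN: "(\<integral>p. complex_of_real (P p) * iexp (\<eta> * X p) \<partial>M) = (\<integral>p. complex_of_real (N p) * iexp (\<eta> * X p) \<partial>M)" for \<eta>
    using zero[of \<eta>] int_iexp[OF P, of \<eta>] int_iexp[OF N, of \<eta>]
    by (simp add: G_eq left_diff_distrib)
  \<comment> \<open>The frequency \<open>0\<close> shows that both parts have the same total mass, hence a common normalisation.\<close>
  define c where "c = (\<integral>p. P p \<partial>M)"
  have c': "(\<integral>p. N p \<partial>M) = c"
  proof -
    have "complex_of_real c = complex_of_real (\<integral>p. N p \<partial>M)"
      using PN[of 0] by (simp add: c_def del: of_real_eq_iff)
    then show ?thesis by simp
  qed
  have ind: "integrable M (\<lambda>p. Q p * indicator A (X p) :: real)" if Q: "integrable M Q" for Q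
    by (rule Bochner_Integration.integrable_bound[OF Q]) (use Q in \<open>auto simp: indicator_def\<close>)
  have split: "(\<integral>p. G p * indicator A (X p) \<partial>M) =
      (\<integral>p. P p * indicator A (X p) \<partial>M) - (\<integral>p. N p * indicator A (X p) \<partial>M)"
    using ind[OF P] ind[OF N] by (simp add: G_eq left_diff_distrib)
  show ?thesis
  proof (cases "c = 0")
    case True
    have "AE p in M. P p = 0" "AE p in M. N p = 0"
      using integral_nonneg_eq_0_iff_AE[OF P] integral_nonneg_eq_0_iff_AE[OF N] True c' nn
      by (auto simp: c_def)
    then have "AE p in M. G p * indicator A (X p) = 0"
      by eventually_elim (simp add: G_eq)
    then have "(\<integral>p. G p * indicator A (X p) \<partial>M) = (\<integral>p. 0 \<partial>M)"
      by (intro integral_cong_AE) auto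
    then show ?thesis by simp
  next
    case False
    have "0 \<le> c" unfolding c_def by (rule Bochner_Integration.integral_nonneg) (simp add: nn)
    with False have c: "c > 0" by simp
    define D where "D Q = distr (density M (\<lambda>p. ennreal (Q p / c))) borel X" for Q :: "'b \<Rightarrow> real"
    have D: "real_distribution (D Q)"
        and char_D: "char (D Q) = (\<lambda>\<eta>. (\<integral>p. complex_of_real (Q p) * iexp (\<eta> * X p) \<partial>M) / c)"
        and meas_D: "measure (D Q) A = (\<integral>p. Q p * indicator A (X p) \<partial>M) / c"
      if Q: "integrable M Q" and Qnn: "\<And>p. 0 \<le> Q p" and Qc: "(\<integral>p. Q p \<partial>M) = c" for Q
    proof -
      have [measurable]: "Q \<in> borel_measurable M" using Q by auto
      have "emeasure (density M (\<lambda>p. ennreal (Q p / c))) (space M) = (\<integral>\<^sup>+p. ennreal (Q p / c) \<partial>M)"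
        by (subst emeasure_density) (auto intro!: nn_integral_cong)
      also have "\<dots> = ennreal (\<integral>p. Q p / c \<partial>M)"
        by (rule nn_integral_eq_integral) (use Q Qnn c in auto)
      also have "\<dots> = 1" using Qc c by simp
      finally have "prob_space (density M (\<lambda>p. ennreal (Q p / c)))"
        by (intro prob_spaceI) simp
      then have "prob_space (D Q)" unfolding D_def
        by (rule prob_space.prob_space_distr) simp
      then show *: "real_distribution (D Q)"
        unfolding real_distribution_def real_distribution_axioms_def by (simp add: D_def)
      show "char (D Q) = (\<lambda>\<eta>. (\<integral>p. complex_of_real (Q p) * iexp (\<eta> * X p) \<partial>M) / c)"
      proof
        fix \<eta>
        have "char (D Q) \<eta> = (\<integral>p. (Q p / c) *\<^sub>R iexp (\<eta> * X p) \<partial>M)"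
          unfolding char_def D_def
          by (subst integral_distr, simp, simp, subst integral_density) (use Qnn c in auto)
        also have "\<dots> = (\<integral>p. complex_of_real (Q p) * iexp (\<eta> * X p) / c \<partial>M)"
          by (simp add: scaleR_conv_of_real)
        finally show "char (D Q) \<eta> = (\<integral>p. complex_of_real (Q p) * iexp (\<eta> * X p) \<partial>M) / c"
          by simp
      qed
      interpret D: real_distribution "D Q" by (rule *)
      have "measure (D Q) A = (\<integral>x. indicator A x \<partial>D Q)" by simp
      also have "\<dots> = (\<integral>p. (Q p / c) *\<^sub>R indicator A (X p) \<partial>M)"
        unfolding D_def
        by (subst integral_distr, simp, simp, subst integral_density) (use Qnn c in auto)
      also have "\<dots> = (\<integral>p. Q p * indicator A (X p) / c \<partial>M)" by simp
      finally show "measure (D Q) A = (\<integral>p. Q p * indicator A (X p) \<partial>M) / c" by simp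
    qed
    have "char (D P) = char (D N)"
      unfolding char_D[OF P nn(1) c_def[symmetric]] char_D[OF N nn(2) c'] PN ..
    then have "D P = D N"
      by (rule Levy_uniqueness[OF D[OF P nn(1) c_def[symmetric]] D[OF N nn(2) c']])
    then show ?thesis
      using meas_D[OF P nn(1) c_def[symmetric]] meas_D[OF N nn(2) c'] c split by simp
  qed
qed

text \<open>Conjugation replaces the frequency \<open>\<eta>\<close> by \<open>-\<eta>\<close>. As the hypothesis covers both signs, it passes to the
  real and the imaginary part of \<open>F\<close>.\<close>
lemma integral_indicator_vimage_eq_0:
  fixes F :: "'b \<Rightarrow> complex" and X :: "'b \<Rightarrow> real"
  assumes F: "integrable M F" and X [measurable]: "X \<in> borel_measurable M"
    and zero: "\<And>\<eta>. (\<integral>p. F p * iexp (\<eta> * X p) \<partial>M) = 0"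
    and A [measurable]: "A \<in> sets borel"
  shows "(\<integral>p. F p * indicator A (X p) \<partial>M) = 0"
proof -
  have [measurable]: "F \<in> borel_measurable M"
    using F by auto
  then have [measurable]: "(\<lambda>p. cnj (F p)) \<in> borel_measurable M"
    using borel_measurable_continuous_onI[OF continuous_on_cnj[OF continuous_on_id]]
    by (rule measurable_compose)
  have int: "integrable M (\<lambda>p. F p * iexp (\<eta> * X p))" for \<eta>
    by (rule Bochner_Integration.integrable_bound[OF F]) (auto simp: norm_mult)
  have int': "integrable M (\<lambda>p. cnj (F p) * iexp (\<eta> * X p))" for \<eta>
    by (rule Bochner_Integration.integrable_bound[OF F]) (auto simp: norm_mult)
  have cnj: "(\<integral>p. cnj (F p) * iexp (\<eta> * X p) \<partial>M) = 0" for \<eta>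
  proof -
    have "(\<integral>p. cnj (F p) * iexp (\<eta> * X p) \<partial>M) = (\<integral>p. cnj (F p * iexp (- \<eta> * X p)) \<partial>M)"
      by (intro Bochner_Integration.integral_cong) (simp_all add: exp_cnj)
    also have "\<dots> = 0"
      using zero[of "- \<eta>"] by (subst Bochner_Integration.integral_cnj) simp
    finally show ?thesis .
  qed
  have Re0: "(\<integral>p. of_real (Re (F p)) * iexp (\<eta> * X p) \<partial>M) = 0" for \<eta>
  proof -
    have "(\<integral>p. of_real (Re (F p)) * iexp (\<eta> * X p) \<partial>M) =
       (\<integral>p. (F p * iexp (\<eta> * X p) + cnj (F p) * iexp (\<eta> * X p)) / 2 \<partial>M)"
      by (intro Bochner_Integration.integral_cong refl)
         (simp add: complex_add_cnj flip: distrib_right)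
    also have "\<dots> = 0"
      using int[of \<eta>] int'[of \<eta>] zero[of \<eta>] cnj[of \<eta>] by simp
    finally show ?thesis .
  qed
  have Im0: "(\<integral>p. of_real (Im (F p)) * iexp (\<eta> * X p) \<partial>M) = 0" for \<eta>
  proof -
    have Im_eq: "complex_of_real (Im (F p)) = (F p - cnj (F p)) / (2 * \<i>)" for p
      by (simp add: complex_eq_iff)
    have "(\<integral>p. of_real (Im (F p)) * iexp (\<eta> * X p) \<partial>M) =
       (\<integral>p. (F p * iexp (\<eta> * X p) - cnj (F p) * iexp (\<eta> * X p)) / (2 * \<i>) \<partial>M)"
      unfolding Im_eq by (simp only: times_divide_eq_left left_diff_distrib)
    also have "\<dots> = 0"
      using int[of \<eta>] int'[of \<eta>] zero[of \<eta>] cnj[of \<eta>] by simp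
    finally show ?thesis .
  qed
  have "Re (\<integral>p. F p * indicator A (X p) \<partial>M) = (\<integral>p. Re (F p) * indicator A (X p) \<partial>M)"
       "Im (\<integral>p. F p * indicator A (X p) \<partial>M) = (\<integral>p. Im (F p) * indicator A (X p) \<partial>M)"
  proof -
    have i: "integrable M (\<lambda>p. F p * indicator A (X p))"
      by (rule Bochner_Integration.integrable_bound[OF F]) (auto simp: norm_mult indicator_def)
    show "Re (\<integral>p. F p * indicator A (X p) \<partial>M) = (\<integral>p. Re (F p) * indicator A (X p) \<partial>M)"
      unfolding integral_Re[OF i, symmetric]
      by (intro Bochner_Integration.integral_cong) (auto simp: indicator_def)
    show "Im (\<integral>p. F p * indicator A (X p) \<partial>M) = (\<integral>p. Im (F p) * indicator A (X p) \<partial>M)"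
      unfolding integral_Im[OF i, symmetric]
      by (intro Bochner_Integration.integral_cong) (auto simp: indicator_def)
  qed
  moreover have "(\<integral>p. Re (F p) * indicator A (X p) \<partial>M) = 0" "(\<integral>p. Im (F p) * indicator A (X p) \<partial>M) = 0"
    using F Re0 Im0 by (auto intro!: integral_indicator_vimage_eq_0_real)
  ultimately show ?thesis by (simp add: complex_eq_iff)
qed

text \<open>The boxes form an intersection-stable generator of the Borel sets, so by Dynkin's argument \<open>F\<close> integrates to zero
  over every Borel set. The hypothesis on the total integral serves the complements.\<close>
lemma AE_eq_0_if_integral_box_eq_0:
  fixes F :: "'a::euclidean_space \<Rightarrow> complex"
  assumes F: "integrable lborel F" and total: "integral\<^sup>L lborel F = 0"
    and box: "\<And>a b. (LINT p:box a b|lborel. F p) = 0"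
  shows "AE p in lborel. F p = 0"
proof -
  have F_on: "set_integrable lborel A F" if "A \<in> sets borel" for A
    using F that unfolding set_integrable_def by (intro integrable_mult_indicator) auto
  have sets_eq: "sets borel = sigma_sets UNIV (range (\<lambda>(a, b). box a b :: 'a set))"
    by (subst borel_eq_box) (simp add: sets_measure_of)
  have all: "(LINT p:A|lborel. F p) = 0" if "A \<in> sets borel" for A
  proof -
    have "Int_stable (range (\<lambda>(a, b). box a b :: 'a set))"
      by (auto simp: Int_stable_def Int_interval)
        (metis (no_types, lifting) box_Int_box case_prod_conv range_eqI)
    moreover have "range (\<lambda>(a, b). box a b :: 'a set) \<subseteq> Pow UNIV" by simp
    ultimately show ?thesis
      using that unfolding sets_eq
    proof (induction rule: sigma_sets_induct_disjoint)
      case (basic A)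
      then show ?case using box by auto
    next
      case empty
      then show ?case by (simp add: set_lebesgue_integral_def)
    next
      case (compl A)
      then have A: "A \<in> sets borel" by (simp add: sets_eq)
      have "(LINT p:UNIV|lborel. F p) = (LINT p:A|lborel. F p) + (LINT p:-A|lborel. F p)"
        using set_integral_Un[OF _ F_on F_on, of A "- A"] A by auto
      then show ?case
        using compl total by (simp add: set_lebesgue_integral_def Compl_eq_Diff_UNIV)
    next
      case (union A)
      then have A: "range A \<subseteq> sets borel" by (simp add: sets_eq)
      have "(LINT p:(\<Union>i. A i)|lborel. F p) = (\<Sum>i. (LINT p:A i|lborel. F p))"
        using A union.hyps
        by (intro lebesgue_integral_countable_add F_on)
           (auto simp: disjoint_family_on_def)
      then show ?case using union by simp
    qed
  qed
  have ReIm: "AE p in lborel. Re (F p) = 0" "AE p in lborel. Im (F p) = 0"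
  proof -
    have "AE p in lborel. Re (F p) = 0"
    proof (rule density_unique_real)
      show "integrable lborel (\<lambda>p. Re (F p))" using F by auto
      fix A :: "'a set" assume "A \<in> sets lborel"
      then have A: "A \<in> sets borel" by simp
      have "(LINT p:A|lborel. Re (F p)) = Re (LINT p:A|lborel. F p)"
        using F_on[OF A] unfolding set_lebesgue_integral_def set_integrable_def
        by (subst integral_Re[symmetric]) auto
      then show "(LINT p:A|lborel. Re (F p)) = (LINT p:A|lborel. 0)"
        using all[OF A] by simp
    qed auto
    moreover have "AE p in lborel. Im (F p) = 0"
    proof (rule density_unique_real)
      show "integrable lborel (\<lambda>p. Im (F p))" using F by auto
      fix A :: "'a set" assume "A \<in> sets lborel"
      then have A: "A \<in> sets borel" by simp
      have "(LINT p:A|lborel. Im (F p)) = Im (LINT p:A|lborel. F p)"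
        using F_on[OF A] unfolding set_lebesgue_integral_def set_integrable_def
        by (subst integral_Im[symmetric]) auto
      then show "(LINT p:A|lborel. Im (F p)) = (LINT p:A|lborel. 0)"
        using all[OF A] by simp
    qed auto
    ultimately show "AE p in lborel. Re (F p) = 0" "AE p in lborel. Im (F p) = 0" by auto
  qed
  then show ?thesis by eventually_elim (simp add: complex_eq_iff)
qed

text \<open>The indicator of a box is a product of indicators of intervals, one for each coordinate. They are inserted into the
  integral one at a time: in each step the one-dimensional lemma is applied to the coordinate function, and the
  remaining exponential is left at an arbitrary frequency so that the next coordinate can be treated.\<close>
lemma AE_eq_0_if_fourier_transform_eq_0:
  fixes F :: "'a::euclidean_space \<Rightarrow> complex"
  assumes F: "integrable lborel F" and zero: "\<And>\<xi>. (\<integral>p. F p * iexp (\<xi> \<bullet> p) \<partial>lborel) = 0"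
  shows "AE p in lborel. F p = 0"
proof (rule AE_eq_0_if_integral_box_eq_0[OF F])
  show "integral\<^sup>L lborel F = 0" using zero[of 0] by simp
  have [measurable]: "F \<in> borel_measurable borel" using F by auto
  fix a b :: 'a
  define \<phi> where "\<phi> B p = (\<Prod>i\<in>B. indicator {a \<bullet> i<..<b \<bullet> i} (p \<bullet> i) :: complex)" for B p
  have [measurable]: "\<phi> B \<in> borel_measurable borel" for B
    unfolding \<phi>_def[abs_def] by measurable
  have norm_\<phi>: "norm (\<phi> B p) \<le> 1" for B p
    unfolding \<phi>_def by (rule order_trans[OF norm_prod_le]) (auto intro!: prod_le_1 simp: indicator_def)
  have "(\<integral>p. F p * \<phi> B p * iexp (\<xi> \<bullet> p) \<partial>lborel) = 0" if "finite B" "B \<subseteq> Basis" for B \<xi>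
    using that
  proof (induction B arbitrary: \<xi>)
    case empty
    then show ?case using zero by (simp add: \<phi>_def)
  next
    case (insert j B)
    have "(\<integral>p. (F p * \<phi> B p * iexp (\<xi> \<bullet> p)) * indicator {a \<bullet> j<..<b \<bullet> j} (p \<bullet> j) \<partial>lborel) = 0"
    proof (rule integral_indicator_vimage_eq_0)
      show "integrable lborel (\<lambda>p. F p * \<phi> B p * iexp (\<xi> \<bullet> p))"
        by (rule Bochner_Integration.integrable_bound[OF F])
           (auto simp: norm_mult intro!: mult_left_le norm_\<phi>)
      fix \<eta>
      \<comment> \<open>The one-dimensional frequency is absorbed into \<open>\<xi>\<close>, which the induction hypothesis leaves free.\<close>
      have "(\<integral>p. F p * \<phi> B p * iexp (\<xi> \<bullet> p) * iexp (\<eta> * (p \<bullet> j)) \<partial>lborel) =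
          (\<integral>p. F p * \<phi> B p * iexp ((\<xi> + \<eta> *\<^sub>R j) \<bullet> p) \<partial>lborel)"
        by (intro Bochner_Integration.integral_cong)
           (simp_all add: inner_add_left inner_commute[of _ j] distrib_left exp_add mult.assoc)
      then show "(\<integral>p. F p * \<phi> B p * iexp (\<xi> \<bullet> p) * iexp (\<eta> * (p \<bullet> j)) \<partial>lborel) = 0"
        using insert by simp
    qed auto
    then show ?case
      using insert.hyps by (simp add: \<phi>_def mult_ac)
  qed
  from this[of Basis 0] have "(\<integral>p. F p * \<phi> Basis p \<partial>lborel) = 0" by simp
  moreover have "\<phi> Basis p = indicator (box a b) p" for p
    unfolding \<phi>_def indicator_def by (auto simp: mem_box)
  ultimately show "(LINT p:box a b|lborel. F p) = 0"
    unfolding set_lebesgue_integral_def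
    by (simp add: scaleR_conv_of_real of_real_indicator mult.commute)
qed

section \<open>Lebesgue measurable functions and their Borel representatives\<close>

lemma measurable_completion_AE:
  assumes g: "g \<in> measurable (completion M) N" and ae: "AE x in M. f x = g x"
    and f: "f \<in> space M \<rightarrow> space N"
  shows "f \<in> measurable (completion M) N"
proof (rule measurableI)
  fix A assume A: "A \<in> sets N"
  show "f -` A \<inter> space (completion M) \<in> sets (completion M)"
  proof (rule completion.in_sets_AE)
    show "AE x in completion M. (x \<in> g -` A \<inter> space (completion M)) = (x \<in> f -` A \<inter> space (completion M))"
      using AE_completion[OF ae] by eventually_elim auto
    show "g -` A \<inter> space (completion M) \<in> sets (completion M)"
      using g A by (rule measurable_sets)
  qed auto
qed (use f in auto)

lemma has_bochner_integral_completion_iff: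
  fixes f :: "'a \<Rightarrow> 'b::{banach, second_countable_topology}"
  assumes g: "g \<in> borel_measurable M" and ae: "AE x in M. f x = g x"
  shows "has_bochner_integral (completion M) f I \<longleftrightarrow> has_bochner_integral M g I"
proof -
  have f: "f \<in> borel_measurable (completion M)"
    using measurable_completion[OF g] ae by (rule measurable_completion_AE) auto
  have "has_bochner_integral (completion M) f I \<longleftrightarrow> has_bochner_integral (completion M) g I"
    using f measurable_completion[OF g] AE_completion[OF ae] by (rule has_bochner_integral_cong_AE)
  also have "\<dots> \<longleftrightarrow> has_bochner_integral M g I"
    using g by (simp add: has_bochner_integral_iff integrable_completion integral_completion)
  finally show ?thesis .
qed

lemma has_bochner_integral_completion_AE:
  fixes f :: "'a \<Rightarrow> 'b::{banach, second_countable_topology}"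
  assumes "integrable M g" "AE x in M. f x = g x"
  shows "has_bochner_integral (completion M) f (integral\<^sup>L M g)"
  using has_bochner_integral_completion_iff[OF borel_measurable_integrable[OF assms(1)] assms(2)]
    has_bochner_integral_integrable[OF assms(1)] by blast

lemma completion_ex_borel_measurable_complex:
  fixes f :: "'a \<Rightarrow> complex"
  assumes f [measurable]: "f \<in> borel_measurable (completion M)"
  shows "\<exists>g\<in>borel_measurable M. AE x in M. f x = g x"
proof -
  obtain g1 where g1: "g1 \<in> borel_measurable M" "AE x in M. Re (f x) = g1 x"
    using completion_ex_borel_measurable_real[of "\<lambda>x. Re (f x)" M] by auto
  obtain g2 where g2: "g2 \<in> borel_measurable M" "AE x in M. Im (f x) = g2 x"
    using completion_ex_borel_measurable_real[of "\<lambda>x. Im (f x)" M] by auto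
  have [measurable]: "g1 \<in> borel_measurable M" "g2 \<in> borel_measurable M" by fact+
  show ?thesis
  proof
    show "AE x in M. f x = of_real (g1 x) + \<i> * of_real (g2 x)"
      using g1(2) g2(2) by eventually_elim (simp add: complex_eq_iff)
  qed measurable
qed

lemma integrable_lebesgue_ex_borel:
  fixes f :: "'a::euclidean_space \<Rightarrow> complex"
  assumes "integrable lebesgue f"
  obtains g where "integrable lborel g" "AE x in lborel. f x = g x"
    "integral\<^sup>L lebesgue f = integral\<^sup>L lborel g"
proof -
  obtain g where g: "g \<in> borel_measurable lborel" "AE x in lborel. f x = g x"
    using completion_ex_borel_measurable_complex[of f lborel] assms by auto
  have "has_bochner_integral lborel g (integral\<^sup>L lebesgue f)"
    using has_bochner_integral_integrable[OF assms] g
    by (simp add: has_bochner_integral_completion_iff)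
  with g show ?thesis
    by (intro that[of g]) (simp_all add: has_bochner_integral_iff)
qed

lemma AE_lborel_prod_snd:
  fixes P :: "'a::euclidean_space \<times> 'b::euclidean_space \<Rightarrow> bool"
  assumes "AE p in lborel. P p"
  shows "AE y in lborel. AE x in lborel. P (x, y)"
proof -
  obtain N where N: "N \<in> sets borel" "N \<in> null_sets lborel" "{p. \<not> P p} \<subseteq> N"
    using assms by (rule AE_E) (auto simp: null_sets_def)
  have N_prod: "N \<in> sets (lborel \<Otimes>\<^sub>M lborel)"
    using N(1) unfolding lborel_prod by simp
  have "AE p in lborel \<Otimes>\<^sub>M lborel. p \<notin> N"
    unfolding lborel_prod using N(2) by (rule AE_not_in)
  then have "AE x in lborel. AE y in lborel. (x, y) \<notin> N"
    by (rule lborel_pair.AE_pair)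
  moreover have "{p \<in> space (lborel \<Otimes>\<^sub>M lborel). (fst p, snd p) \<notin> N} \<in> sets (lborel \<Otimes>\<^sub>M lborel)"
  proof -
    have "{p \<in> space (lborel \<Otimes>\<^sub>M lborel). (fst p, snd p) \<notin> N} = - N"
      by (auto simp: space_pair_measure)
    then show ?thesis
      using N(1) unfolding lborel_prod by simp
  qed
  ultimately have "AE y in lborel. AE x in lborel. (x, y) \<notin> N"
    using lborel_pair.AE_commute[of "\<lambda>x y. (x, y) \<notin> N"] by blast
  then show ?thesis
  proof eventually_elim
    fix y assume "AE x in lborel. (x, y) \<notin> N"
    then show "AE x in lborel. P (x, y)"
      by eventually_elim (use N(3) in auto)
  qed
qed

text \<open>Fubini's theorem for the completed measure: a Lebesgue integrable function agrees with a Borel function outside a null set,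
  and almost every section of that null set is null.\<close>
lemma integral_lebesgue_prod_snd:
  fixes f :: "'a::euclidean_space \<times> 'b::euclidean_space \<Rightarrow> complex"
  assumes f: "integrable lebesgue f"
  shows "(\<integral>y. (\<integral>x. f (x, y) \<partial>lebesgue) \<partial>lebesgue) = integral\<^sup>L lebesgue f"
proof -
  obtain g where g: "integrable lborel g" "AE p in lborel. f p = g p"
      "integral\<^sup>L lebesgue f = integral\<^sup>L lborel g"
    by (rule integrable_lebesgue_ex_borel[OF f])
  have g': "integrable (lborel \<Otimes>\<^sub>M lborel) (\<lambda>(x, y). g (x, y))"
    using g(1) by (simp add: lborel_prod)
  have "AE y in lborel. (\<integral>x. f (x, y) \<partial>lebesgue) = (\<integral>x. g (x, y) \<partial>lborel)"
    using AE_lborel_prod_snd[OF g(2)] lborel_pair.AE_integrable_snd[OF g']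
    by eventually_elim (auto intro!: has_bochner_integral_integral_eq has_bochner_integral_completion_AE)
  from has_bochner_integral_integral_eq[OF
      has_bochner_integral_completion_AE[OF lborel_pair.integrable_snd[OF g'] this]]
  show ?thesis
    using lborel_pair.integral_snd[OF g'] g(3) by (simp add: lborel_prod)
qed

section \<open>The Fourier-Laplace transform as one integral over space-time\<close>

text \<open>The kernel of the Fourier-Laplace transform as a function of the space-time point. It is a multiplicative
  character of space-time, and on a vertical line \<open>Re s = \<rho>\<close> it is a fixed damping factor times a unitary character.\<close>
definition fl_character :: "'a::euclidean_space \<Rightarrow> complex \<Rightarrow> 'a \<times> real \<Rightarrow> complex" where
  "fl_character \<xi> s p = exp (\<i> * of_real (\<xi> \<bullet> fst p) - s * of_real (snd p))"

lemma fl_character_add: "fl_character \<xi> s (p + q) = fl_character \<xi> s p * fl_character \<xi> s q"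
  by (simp add: fl_character_def inner_add_right algebra_simps flip: exp_add)

lemma fl_character_measurable [measurable]: "fl_character \<xi> s \<in> borel_measurable borel"
  unfolding fl_character_def[abs_def] by (intro borel_measurable_continuous_onI continuous_intros)

lemma norm_fl_character: "norm (fl_character \<xi> s p) = exp (- Re s * snd p)"
  by (simp add: fl_character_def)

lemma fl_character_mult_iexp:
  "fl_character 0 (of_real \<rho>) p * iexp ((\<xi>, \<eta>) \<bullet> p) = fl_character \<xi> (Complex \<rho> (- \<eta>)) p"
proof -
  have "\<i> * of_real ((0::'a) \<bullet> fst p) - of_real \<rho> * of_real (snd p) + \<i> * of_real ((\<xi>, \<eta>) \<bullet> p)
      = \<i> * of_real (\<xi> \<bullet> fst p) - Complex \<rho> (- \<eta>) * of_real (snd p)"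
    by (simp add: inner_prod_def complex_eq_iff)
  then show ?thesis
    by (simp only: fl_character_def flip: exp_add)
qed

lemma fourier_laplace_convergesD:
  assumes "fourier_laplace_converges w \<sigma>" "\<sigma> \<le> Re s"
  shows "set_integrable lebesgue (UNIV \<times> {0..}) (\<lambda>p. fl_character \<xi> s p * w (fst p) (snd p))"
proof -
  have w: "integrable lebesgue (\<lambda>p. indicator (UNIV \<times> {0..}) p *\<^sub>R (of_real (exp (- \<sigma> * snd p)) * w (fst p) (snd p)))"
    using assms(1) by (simp add: fourier_laplace_converges_def set_integrable_def case_prod_unfold)
  have eq: "indicator (UNIV \<times> {0..}) p *\<^sub>R (fl_character \<xi> s p * w (fst p) (snd p)) =
     (fl_character \<xi> s p * of_real (exp (\<sigma> * snd p))) *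
     (indicator (UNIV \<times> {0..}) p *\<^sub>R (of_real (exp (- \<sigma> * snd p)) * w (fst p) (snd p)))" for p
  proof -
    have "of_real (exp (\<sigma> * snd p)) * of_real (exp (- \<sigma> * snd p)) = (1::complex)"
      by (simp flip: of_real_mult exp_add)
    then show ?thesis
      by (simp add: mult.commute[of "complex_of_real (exp (- (\<sigma> * snd p)))"])
  qed
  show ?thesis
    unfolding set_integrable_def
  proof (rule Bochner_Integration.integrable_bound[OF w])
    show "(\<lambda>p. indicator (UNIV \<times> {0..}) p *\<^sub>R (fl_character \<xi> s p * w (fst p) (snd p))) \<in> borel_measurable lebesgue"
      unfolding eq
    proof (rule borel_measurable_times)
      show "(\<lambda>p. fl_character \<xi> s p * of_real (exp (\<sigma> * snd p))) \<in> borel_measurable lebesgue"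
      proof (rule measurable_completion)
        have "(\<lambda>p. fl_character \<xi> s p * of_real (exp (\<sigma> * snd p))) \<in> borel_measurable borel"
          by (intro borel_measurable_times fl_character_measurable borel_measurable_continuous_onI continuous_intros)
        then show "(\<lambda>p. fl_character \<xi> s p * of_real (exp (\<sigma> * snd p))) \<in> borel_measurable lborel"
          by simp
      qed
    qed (use w in \<open>rule borel_measurable_integrable\<close>)
    have "exp (- (Re s * snd p)) \<le> exp (- (\<sigma> * snd p))" if "snd p \<ge> 0" for p :: "'a \<times> real"
      using that assms(2) by (simp add: mult_right_mono)
    then show "AE p in lebesgue. norm (indicator (UNIV \<times> {0..}) p *\<^sub>R (fl_character \<xi> s p * w (fst p) (snd p)))
       \<le> norm (indicator (UNIV \<times> {0..}) p *\<^sub>R (of_real (exp (- \<sigma> * snd p)) * w (fst p) (snd p)))"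
      by (intro AE_I2) (auto simp: norm_mult norm_fl_character indicator_def intro!: mult_right_mono)
  qed
qed

text \<open>Absolute convergence at \<open>\<sigma>\<close> dominates the integrand for all \<open>s\<close> with larger real part, so Fubini's theorem applies to
  the iterated integral that defines the transform.\<close>
lemma fourier_laplace_eq_set_integral:
  assumes "fourier_laplace_converges w \<sigma>" "\<sigma> \<le> Re s"
  shows "fourier_laplace w \<xi> s = (LINT p:UNIV \<times> {0..}|lebesgue. fl_character \<xi> s p * w (fst p) (snd p))"
proof -
  have inner: "(\<integral>x. indicator (UNIV \<times> {0..}) (x, t) *\<^sub>R (fl_character \<xi> s (x, t) * w x t) \<partial>lebesgue) =
      indicator {0..} t *\<^sub>R (exp (- s * of_real t) * (\<integral>x. exp (\<i> * of_real (\<xi> \<bullet> x)) * w x t \<partial>lebesgue))" for t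
  proof -
    have "indicator (UNIV \<times> {0..}) (x, t) *\<^sub>R (fl_character \<xi> s (x, t) * w x t) =
       (indicator {0..} t *\<^sub>R exp (- s * of_real t)) * (exp (\<i> * of_real (\<xi> \<bullet> x)) * w x t)" for x
      by (simp add: fl_character_def indicator_def exp_diff exp_minus divide_inverse)
    then show ?thesis by simp
  qed
  have "(LINT p:UNIV \<times> {0..}|lebesgue. fl_character \<xi> s p * w (fst p) (snd p)) =
      (\<integral>t. (\<integral>x. indicator (UNIV \<times> {0..}) (x, t) *\<^sub>R (fl_character \<xi> s (x, t) * w x t) \<partial>lebesgue) \<partial>lebesgue)"
    using integral_lebesgue_prod_snd[OF fourier_laplace_convergesD[OF assms, unfolded set_integrable_def], of \<xi>]
    by (simp add: set_lebesgue_integral_def)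
  then show ?thesis
    unfolding inner fourier_laplace_def set_lebesgue_integral_def by simp
qed

lemma fl_character_0_of_real: "fl_character 0 (of_real \<sigma>) p = of_real (exp (- \<sigma> * snd p))"
  by (simp add: fl_character_def exp_of_real[symmetric])

lemma fourier_laplace_converges_iff:
  "fourier_laplace_converges w \<sigma> \<longleftrightarrow>
     set_integrable lebesgue (UNIV \<times> {0..}) (\<lambda>p. fl_character 0 (of_real \<sigma>) p * w (fst p) (snd p))"
  by (simp add: fourier_laplace_converges_def fl_character_0_of_real case_prod_unfold)

lemma fourier_laplace_converges_mono:
  assumes "fourier_laplace_converges w \<sigma>" "\<sigma> \<le> \<sigma>'"
  shows "fourier_laplace_converges w \<sigma>'"
  unfolding fourier_laplace_converges_iff using assms by (intro fourier_laplace_convergesD) auto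

text \<open>All computations with a transform are done with a Borel function on space-time that vanishes at negative times; such
  a function \<open>W\<close> may replace \<open>w\<close> as soon as both agree almost everywhere at nonnegative times.\<close>
lemma fourier_laplace_borel:
  fixes w :: "'a::euclidean_space \<Rightarrow> real \<Rightarrow> complex"
  assumes W: "W \<in> borel_measurable borel"
    and ae: "AE p in lborel. indicator {0..} (snd p) *\<^sub>R w (fst p) (snd p) = W p"
  shows fourier_laplace_converges_borel_iff:
      "fourier_laplace_converges w \<sigma> \<longleftrightarrow> integrable lborel (\<lambda>p. fl_character 0 (of_real \<sigma>) p * W p)"
    and has_bochner_integral_fourier_laplace:
      "\<lbrakk>fourier_laplace_converges w \<sigma>; \<sigma> \<le> Re s\<rbrakk> \<Longrightarrow>
         has_bochner_integral lborel (\<lambda>p. fl_character \<xi> s p * W p) (fourier_laplace w \<xi> s)"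
proof -
  have meas: "(\<lambda>p. fl_character \<xi> s p * W p) \<in> borel_measurable lborel" for \<xi> s
    using W by simp
  have ae': "AE p in lborel. indicator (UNIV \<times> {0..}) p *\<^sub>R (fl_character \<xi> s p * w (fst p) (snd p)) =
      fl_character \<xi> s p * W p" for \<xi> s
    using ae
  proof eventually_elim
    fix p assume "indicator {0..} (snd p) *\<^sub>R w (fst p) (snd p) = W p"
    then show "indicator (UNIV \<times> {0..}) p *\<^sub>R (fl_character \<xi> s p * w (fst p) (snd p)) = fl_character \<xi> s p * W p"
      by (cases p) (auto simp: indicator_def split: if_splits)
  qed
  note iff = has_bochner_integral_completion_iff[OF meas ae']
  show "fourier_laplace_converges w \<sigma> \<longleftrightarrow> integrable lborel (\<lambda>p. fl_character 0 (of_real \<sigma>) p * W p)"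
    unfolding fourier_laplace_converges_iff set_integrable_def integrable.simps iff ..
  show "has_bochner_integral lborel (\<lambda>p. fl_character \<xi> s p * W p) (fourier_laplace w \<xi> s)"
    if "fourier_laplace_converges w \<sigma>" "\<sigma> \<le> Re s"
    using fourier_laplace_convergesD[OF that, of \<xi>] fourier_laplace_eq_set_integral[OF that, of \<xi>]
    by (subst iff[symmetric]) (simp add: has_bochner_integral_iff set_integrable_def set_lebesgue_integral_def)
qed

text \<open>On a line \<open>Re s = \<rho>\<close> inside the region of convergence, the Fourier-Laplace transform of \<open>w - v\<close> is the Fourier transform of
  the integrable function \<open>exp (- \<rho> t) (w - v)\<close>, extended by zero to negative times.\<close>
lemma fourier_laplace_inject_AE:
  fixes v w :: "'a::euclidean_space \<Rightarrow> real \<Rightarrow> complex"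
  assumes v: "fourier_laplace_converges v \<sigma>" and w: "fourier_laplace_converges w \<sigma>"
    and eq: "\<And>\<xi> s. \<sigma> < Re s \<Longrightarrow> fourier_laplace w \<xi> s = fourier_laplace v \<xi> s"
  shows "AE p in lebesgue. snd p \<ge> 0 \<longrightarrow> w (fst p) (snd p) = v (fst p) (snd p)"
proof -
  define \<rho> where "\<rho> = \<sigma> + 1"
  define I :: "'a \<times> real \<Rightarrow> real" where "I = indicator (UNIV \<times> {0..})"
  define h where "h p = I p *\<^sub>R (w (fst p) (snd p) - v (fst p) (snd p))" for p
  define F where "F p = fl_character 0 (of_real \<rho>) p * h p" for p
  have h_eq: "fl_character \<xi> s p * h p = I p *\<^sub>R (fl_character \<xi> s p * w (fst p) (snd p)) -
       I p *\<^sub>R (fl_character \<xi> s p * v (fst p) (snd p))" for \<xi> s p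
    by (simp add: h_def right_diff_distrib scaleR_diff_right)
  have int: "integrable lebesgue (\<lambda>p. fl_character \<xi> s p * h p)"
    and zero: "(\<integral>p. fl_character \<xi> s p * h p \<partial>lebesgue) = 0" if "\<sigma> < Re s" for \<xi> s
    using that fourier_laplace_convergesD[OF v, of s \<xi>] fourier_laplace_convergesD[OF w, of s \<xi>]
      fourier_laplace_eq_set_integral[OF v, of s \<xi>] fourier_laplace_eq_set_integral[OF w, of s \<xi>] eq[of s \<xi>]
    unfolding h_eq I_def set_lebesgue_integral_def set_integrable_def by auto
  have "integrable lebesgue F"
    unfolding F_def[abs_def] by (rule int) (simp add: \<rho>_def)
  then obtain G where G: "integrable lborel G" "AE p in lborel. F p = G p"
    by (rule integrable_lebesgue_ex_borel)
  have "AE p in lborel. G p = 0"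
  proof (rule AE_eq_0_if_fourier_transform_eq_0[OF G(1)])
    fix \<zeta> :: "'a \<times> real"
    obtain \<xi> \<eta> where \<zeta>: "\<zeta> = (\<xi>, \<eta>)" by (cases \<zeta>)
    have Gi: "integrable lborel (\<lambda>p. G p * iexp (\<zeta> \<bullet> p))"
      by (rule Bochner_Integration.integrable_bound[OF G(1)])
         (use G(1) in \<open>auto simp: norm_mult intro!: borel_measurable_times borel_measurable_continuous_onI continuous_intros\<close>)
    have "AE p in lborel. fl_character \<xi> (Complex \<rho> (- \<eta>)) p * h p = G p * iexp (\<zeta> \<bullet> p)"
      using G(2)
    proof eventually_elim
      fix p assume "F p = G p"
      then show "fl_character \<xi> (Complex \<rho> (- \<eta>)) p * h p = G p * iexp (\<zeta> \<bullet> p)"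
        unfolding \<zeta> fl_character_mult_iexp[symmetric] by (simp only: F_def flip: mult_ac)
    qed
    from has_bochner_integral_integral_eq[OF has_bochner_integral_completion_AE[OF Gi this]]
    show "(\<integral>p. G p * iexp (\<zeta> \<bullet> p) \<partial>lborel) = 0"
      using zero[of "Complex \<rho> (- \<eta>)" \<xi>] by (simp add: \<rho>_def)
  qed
  with G(2) have "AE p in lborel. snd p \<ge> 0 \<longrightarrow> w (fst p) (snd p) = v (fst p) (snd p)"
    by eventually_elim (auto simp: F_def h_def I_def fl_character_def indicator_def mem_Times_iff)
  then show ?thesis by (rule AE_completion)
qed

text \<open>A nonempty open set is not a null set, so the functions agree at all positive times, and by continuity also at time
  \<open>0\<close>.\<close>
lemma continuous_eq_if_AE_eq:
  fixes v w :: "'a::euclidean_space \<Rightarrow> real \<Rightarrow> complex"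
  assumes ae: "AE p in lebesgue. snd p \<ge> 0 \<longrightarrow> w (fst p) (snd p) = v (fst p) (snd p)"
    and v: "continuous_on (UNIV \<times> {0..}) (\<lambda>p. v (fst p) (snd p))"
    and w: "continuous_on (UNIV \<times> {0..}) (\<lambda>p. w (fst p) (snd p))"
    and t: "t \<ge> 0"
  shows "w x t = v x t"
proof -
  define S where "S = (UNIV :: 'a set) \<times> {0::real<..}"
  have "closure S = UNIV \<times> {0..}"
    unfolding S_def closure_Times by (simp add: closure_greaterThan)
  then have "(x, t) \<in> closure S" using t by simp
  define D where "D p = w (fst p) (snd p) - v (fst p) (snd p)" for p
  have D: "continuous_on (UNIV \<times> {0..}) D"
    unfolding D_def[abs_def] by (intro continuous_intros v w)
  have D_0: "D p = 0" if "p \<in> S" for p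
  proof (rule ccontr)
    assume "D p \<noteq> 0"
    have op: "open S" unfolding S_def by (intro open_Times) auto
    have "continuous_on S D"
      by (rule continuous_on_subset[OF D]) (auto simp: S_def)
    then have "open (S \<inter> D -` (- {0}))"
      using op by (rule continuous_open_preimage) (simp add: open_Compl)
    moreover have "S \<inter> D -` (- {0}) \<noteq> {}" using that \<open>D p \<noteq> 0\<close> by auto
    ultimately have "\<not> negligible (S \<inter> D -` (- {0}))"
      by (rule open_not_negligible)
    moreover have "negligible {p. \<not> (snd p \<ge> 0 \<longrightarrow> w (fst p) (snd p) = v (fst p) (snd p))}"
      using ae by (simp add: completion.AE_iff_null_sets negligible_iff_null_sets)
    ultimately show False
      by (elim notE, elim negligible_subset) (auto simp: S_def D_def)
  qed
  have "continuous_on (closure S) D"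
    unfolding \<open>closure S = _\<close> by (rule D)
  then have "D (x, t) = 0"
    using D_0 \<open>(x, t) \<in> closure S\<close> by (rule continuous_constant_on_closure)
  then show ?thesis by (simp add: D_def)
qed

section \<open>Borel modifications of functions that are continuous in space\<close>

text \<open>A function that is measurable in one variable and continuous in the other is jointly measurable: it is the pointwise limit of
  the functions obtained by replacing \<open>x\<close> with the first point of a dense sequence at distance less than
  \<open>1 / Suc n\<close>.\<close>
lemma caratheodory_measurable:
  fixes U :: "'a::{metric_space, second_countable_topology} \<Rightarrow> 'b \<Rightarrow> real"
  assumes D: "countable D" "closure D = UNIV"
    and meas: "\<And>q. q \<in> D \<Longrightarrow> U q \<in> borel_measurable M"
    and cont: "\<And>t. t \<in> space M \<Longrightarrow> continuous_on UNIV (\<lambda>x. U x t)"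
  shows "(\<lambda>p. U (fst p) (snd p)) \<in> borel_measurable (borel \<Otimes>\<^sub>M M)"
proof -
  have "D \<noteq> {}" using D(2) by auto
  define q where "q = from_nat_into D"
  have q: "q k \<in> D" for k unfolding q_def using \<open>D \<noteq> {}\<close> by (rule from_nat_into)
  have near: "\<exists>k. dist x (q k) < 1 / Suc n" for x n
  proof -
    have "x \<in> closure D" using D(2) by simp
    then obtain d where "d \<in> D" "dist d x < 1 / Suc n"
      by (metis closure_approachable of_nat_0_less_iff zero_less_Suc zero_less_divide_1_iff)
    then show ?thesis
      using from_nat_into_surj[OF D(1)] unfolding q_def by (metis dist_commute)
  qed
  define K where "K n p = (LEAST k. dist (fst p) (q k) < 1 / Suc n)" for n and p :: "'a \<times> 'b"
  have K: "dist (fst p) (q (K n p)) < 1 / Suc n" for n p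
    unfolding K_def using near[of "fst p" n] by (rule LeastI_ex)
  have K_meas: "K n \<in> measurable (borel \<Otimes>\<^sub>M M) (count_space UNIV)" for n
    unfolding K_def[abs_def] by measurable
  show ?thesis
  proof (rule borel_measurable_LIMSEQ_real)
    fix n
    have "(\<lambda>p. U (q k) (snd p)) \<in> borel_measurable (borel \<Otimes>\<^sub>M M)" for k
      using meas[OF q[of k]] by measurable
    then show "(\<lambda>p. U (q (K n p)) (snd p)) \<in> borel_measurable (borel \<Otimes>\<^sub>M M)"
      using K_meas by (rule measurable_compose_countable)
  next
    fix p :: "'a \<times> 'b" assume "p \<in> space (borel \<Otimes>\<^sub>M M)"
    then have "snd p \<in> space M" by (auto simp: space_pair_measure)
    have "(\<lambda>n. dist (fst p) (q (K n p))) \<longlonglongrightarrow> 0"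
      using LIMSEQ_inverse_real_of_nat
    proof (rule real_tendsto_sandwich[rotated 3, of _ _ _ "\<lambda>_. 0"])
      show "\<forall>\<^sub>F n in sequentially. dist (fst p) (q (K n p)) \<le> inverse (real (Suc n))"
        using K[of p] by (intro always_eventually) (simp add: inverse_eq_divide less_imp_le)
    qed auto
    then have "(\<lambda>n. q (K n p)) \<longlonglongrightarrow> fst p"
      unfolding tendsto_dist_iff[of "\<lambda>n. q (K n p)"] by (simp only: dist_commute)
    then show "(\<lambda>n. U (q (K n p)) (snd p)) \<longlonglongrightarrow> U (fst p) (snd p)"
      using continuous_on_tendsto_compose[OF cont[OF \<open>snd p \<in> space M\<close>]] by simp
  qed
qed

lemma AE_lborel_dense:
  fixes P :: "'a::euclidean_space \<Rightarrow> bool"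
  assumes "AE x in lborel. P x"
  obtains D where "countable D" "closure D = UNIV" "\<forall>x\<in>D. P x"
proof -
  have neg: "negligible {x. \<not> P x}"
    using AE_completion[OF assms] by (simp add: completion.AE_iff_null_sets negligible_iff_null_sets)
  have "closure {x. P x} = UNIV"
  proof (rule ccontr)
    assume "closure {x. P x} \<noteq> UNIV"
    then have "\<not> negligible (- closure {x. P x})"
      by (intro open_not_negligible) auto
    moreover have "- closure {x. P x} \<subseteq> {x. \<not> P x}"
      using closure_subset[of "{x. P x}"] by blast
    ultimately show False
      using negligible_subset[OF neg] by blast
  qed
  moreover obtain D where "countable D" "D \<subseteq> {x. P x}" "{x. P x} \<subseteq> closure D"
    by (rule separable)
  ultimately show ?thesis
    using that[of D] closure_minimal[of "{x. P x}" "closure D"] by auto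
qed

text \<open>By Fubini's theorem almost every spatial point has a section in time that agrees with a Borel function outside a null set.
  Countably many such points are dense, so their null sets can be united to one null set \<open>N\<close> of times. Outside \<open>N\<close> the
  sections at the dense points are Borel, and continuity in space does the rest. Only whole time slices are
  removed, so a line that is not parallel to the slices meets the exceptional set in a null set.\<close>
lemma ex_borel_modification:
  fixes u :: "'a::euclidean_space \<Rightarrow> real \<Rightarrow> real"
  assumes u: "(\<lambda>p. indicator {0..} (snd p) * u (fst p) (snd p)) \<in> borel_measurable lebesgue"
    and cont: "\<And>t. t \<ge> 0 \<Longrightarrow> continuous_on UNIV (\<lambda>x. u x t)"
  obtains N where "N \<in> null_sets lborel"
    "(\<lambda>p. indicator ({0..} - N) (snd p) * u (fst p) (snd p)) \<in> borel_measurable borel"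
proof -
  obtain g where g: "g \<in> borel_measurable lborel"
      and ug: "AE p in lborel. indicator {0..} (snd p) * u (fst p) (snd p) = g p"
    using completion_ex_borel_measurable_real[OF u] by auto
  have [measurable]: "g \<in> borel_measurable (borel \<Otimes>\<^sub>M borel)"
    using g by (simp add: borel_prod)
  have "AE p in lborel \<Otimes>\<^sub>M lborel. indicator {0..} (snd p) * u (fst p) (snd p) = g p"
    unfolding lborel_prod by (rule ug)
  from lborel_pair.AE_pair[OF this]
  have "AE x in lborel. AE t in lborel. indicator {0..} t * u x t = g (x, t)"
    by simp
  then obtain D where D: "countable D" "closure D = UNIV"
      "\<forall>x\<in>D. AE t in lborel. indicator {0..} t * u x t = g (x, t)"
    by (rule AE_lborel_dense)
  have "AE t in lborel. \<forall>x\<in>D. indicator {0..} t * u x t = g (x, t)"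
    using D by (simp add: AE_ball_countable)
  then obtain N where N: "N \<in> null_sets lborel" "{t. \<not> (\<forall>x\<in>D. indicator {0..} t * u x t = g (x, t))} \<subseteq> N"
    by (rule AE_E) (auto simp: null_sets_def)
  have [measurable]: "N \<in> sets borel" using N(1) by auto
  have "(\<lambda>p. indicator ({0..} - N) (snd p) * u (fst p) (snd p)) \<in> borel_measurable (borel \<Otimes>\<^sub>M borel)"
  proof (rule caratheodory_measurable[OF D(1,2)])
    fix x assume "x \<in> D"
    then have "indicator {0..} t * u x t = g (x, t)" if "t \<notin> N" for t
      using N(2) that by blast
    then have "indicator ({0..} - N) t * u x t = indicator (- N) t * g (x, t)" for t
      by (cases "t \<in> N") (simp_all add: indicator_diff)
    then show "(\<lambda>t. indicator ({0..} - N) t * u x t) \<in> borel_measurable borel"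
      by simp
  next
    fix t :: real
    show "continuous_on UNIV (\<lambda>x. indicator ({0..} - N) t * u x t)"
      using cont[of t] by (cases "t \<ge> 0") (auto intro!: continuous_intros)
  qed
  with N(1) show ?thesis
    by (intro that[of N]) (simp_all add: borel_prod)
qed

text \<open>Convergence of the transform includes measurability of the damped function, and the damping factor can be removed.\<close>
lemma measurable_if_fourier_laplace_converges:
  fixes u :: "'a::euclidean_space \<Rightarrow> real \<Rightarrow> real"
  assumes "fourier_laplace_converges (\<lambda>x t. complex_of_real (u x t)) \<sigma>"
  shows "(\<lambda>p. indicator {0..} (snd p) * u (fst p) (snd p)) \<in> borel_measurable lebesgue"
proof -
  let ?f = "\<lambda>p. indicator (UNIV \<times> {0..}) p *\<^sub>R (fl_character 0 (of_real \<sigma>) p * complex_of_real (u (fst p) (snd p)))"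
  have [measurable]: "?f \<in> borel_measurable lebesgue"
    using assms unfolding fourier_laplace_converges_iff set_integrable_def by (rule borel_measurable_integrable)
  have "(\<lambda>p::'a \<times> real. exp (\<sigma> * snd p)) \<in> borel_measurable borel"
    by (intro borel_measurable_continuous_onI continuous_intros)
  then have [measurable]: "(\<lambda>p::'a \<times> real. exp (\<sigma> * snd p)) \<in> borel_measurable lebesgue"
    by (intro measurable_completion) simp
  have "exp (\<sigma> * t) * (exp (- (\<sigma> * t)) * y) = y" for t y :: real
    by (simp add: mult.assoc[symmetric] flip: exp_add)
  then have "exp (\<sigma> * snd p) * Re (?f p) = indicator {0..} (snd p) * u (fst p) (snd p)" for p
    by (cases p) (simp add: fl_character_0_of_real indicator_def)
  moreover have "(\<lambda>p. exp (\<sigma> * snd p) * Re (?f p)) \<in> borel_measurable lebesgue"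
    by measurable
  ultimately show ?thesis by (simp only:)
qed

section \<open>The Laplace transform of the Riemann-Liouville kernel\<close>

text \<open>The Riemann-Liouville kernel without its factor \<open>1 / \<Gamma>(\<alpha>)\<close>. The indicator allows integrals over \<open>[0, t]\<close> to
  be written as integrals over the whole line.\<close>
definition rl_kernel :: "real \<Rightarrow> real \<Rightarrow> real" where
  "rl_kernel \<alpha> \<tau> = indicator {0..} \<tau> * \<tau> powr (\<alpha> - 1)"

lemma rl_kernel_nonneg: "0 \<le> rl_kernel \<alpha> \<tau>"
  by (simp add: rl_kernel_def)

lemma rl_kernel_measurable [measurable]: "rl_kernel \<alpha> \<in> borel_measurable borel"
  unfolding rl_kernel_def[abs_def] by measurable

text \<open>The substitution \<open>\<tau> \<mapsto> c \<tau>\<close> in Euler's integral.\<close>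
lemma laplace_rl_kernel_real:
  assumes "0 < \<alpha>" "0 < c"
  shows "has_bochner_integral lborel (\<lambda>\<tau>. rl_kernel \<alpha> \<tau> * exp (- c * \<tau>)) (Gamma \<alpha> * c powr (- \<alpha>))"
proof -
  have "has_bochner_integral lborel (\<lambda>\<tau>. rl_kernel \<alpha> \<tau> * exp (- \<tau>)) (Gamma \<alpha>)"
  proof (rule has_bochner_integral_nn_integral)
    show "(\<integral>\<^sup>+ x. ennreal (rl_kernel \<alpha> x * exp (- x)) \<partial>lborel) = ennreal (Gamma \<alpha>)"
      unfolding Gamma_conv_nn_integral_real[OF assms(1)]
      by (simp add: rl_kernel_def exp_minus divide_inverse)
    show "0 \<le> Gamma \<alpha>" using Gamma_real_pos[OF assms(1)] by simp
  qed (auto simp: rl_kernel_nonneg)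
  from has_bochner_integral_mult_right[OF lborel_has_bochner_integral_real_affine_iff[THEN iffD1, OF _ this, of c 0], of "c powr (1 - \<alpha>)"] assms
  have "has_bochner_integral lborel (\<lambda>\<tau>. c powr (1 - \<alpha>) * (rl_kernel \<alpha> (c * \<tau>) * exp (- (c * \<tau>))))
     (c powr (1 - \<alpha>) * (Gamma \<alpha> / c))"
    by (simp add: divide_inverse mult_ac)
  moreover have "c powr (1 - \<alpha>) * rl_kernel \<alpha> (c * \<tau>) = rl_kernel \<alpha> \<tau>" for \<tau>
    using assms
    by (auto simp: rl_kernel_def powr_mult zero_le_mult_iff indicator_def powr_add[symmetric] mult.assoc[symmetric])
  moreover have "c powr (1 - \<alpha>) * (Gamma \<alpha> / c) = Gamma \<alpha> * c powr (- \<alpha>)"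
    using assms by (simp add: powr_diff powr_minus field_simps)
  ultimately show ?thesis
    by (simp add: mult.assoc[symmetric])
qed

text \<open>The negative binomial coefficients are rising factorials up to a sign, which cancels against the sign of the
  argument.\<close>
lemma gbinomial_minus_times_power:
  fixes x :: "'x :: {real_normed_field, field_char_0}"
  shows "(- of_real \<alpha> gchoose n) * (- x / of_real c) ^ n
    = of_real (pochhammer \<alpha> n) / fact n * (x ^ n / of_real c ^ n)"
proof -
  have "(- x / of_real c) ^ n = (- 1) ^ n * (x ^ n / of_real c ^ n)"
    by (simp add: power_divide power_minus[of "x / of_real c"])
  moreover have "(- of_real \<alpha> gchoose n) = (- 1) ^ n * (of_real (pochhammer \<alpha> n) / fact n :: 'x)"
    by (simp add: gbinomial_pochhammer pochhammer_of_real)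
  moreover have "(- 1) ^ n * ((- 1) ^ n * y) = (y :: 'x)" for y
    by (simp add: mult.assoc[symmetric] flip: power_mult_distrib)
  moreover have "((- 1) ^ n * A) * ((- 1) ^ n * B) = (- 1) ^ n * ((- 1) ^ n * (A * B))" for A B :: 'x
    by (rule mult.assoc[THEN trans], rule arg_cong[where f = "(*) _"], rule mult.left_commute)
  ultimately show ?thesis
    by (metis (no_types))
qed

text \<open>Write \<open>z = c - w\<close> with a real \<open>c\<close> so large that \<open>|w| < c\<close> and expand \<open>exp (w \<tau>)\<close> into its power
  series. Integrating term by term gives the values \<open>\<Gamma>(\<alpha> + n) c\<^sup>-\<^sup>\<alpha>\<^sup>-\<^sup>n w\<^sup>n / n!\<close>, and these are the
  terms of the binomial series of \<open>\<Gamma>(\<alpha>) c\<^sup>-\<^sup>\<alpha> (1 - w / c)\<^sup>-\<^sup>\<alpha> = \<Gamma>(\<alpha>) z\<^sup>-\<^sup>\<alpha>\<close>.\<close>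
lemma laplace_rl_kernel:
  fixes z :: complex
  assumes "0 < \<alpha>" "0 < Re z"
  shows "has_bochner_integral lborel (\<lambda>\<tau>. of_real (rl_kernel \<alpha> \<tau>) * exp (- z * of_real \<tau>))
           (of_real (Gamma \<alpha>) * z powr (- of_real \<alpha>))"
proof -
  \<comment> \<open>Any \<open>c > |z|\<^sup>2 / (2 Re z)\<close> satisfies \<open>|c - z| < c\<close>.\<close>
  define c where "c = (cmod z)\<^sup>2 / Re z"
  have zpos: "0 < cmod z" using assms by auto
  then have c: "0 < c" using assms unfolding c_def by simp
  define w where "w = complex_of_real c - z"
  have "(cmod w)\<^sup>2 < c\<^sup>2"
  proof -
    have "(cmod w)\<^sup>2 = c\<^sup>2 - 2 * (c * Re z) + (cmod z)\<^sup>2"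
      unfolding w_def cmod_power2 by (simp add: power2_eq_square algebra_simps)
    also have "c * Re z = (cmod z)\<^sup>2" using assms by (simp add: c_def)
    finally show ?thesis using zpos by simp
  qed
  then have wc: "cmod w < c" using c by (simp add: power2_less_imp_less)
  define f where "f n \<tau> = of_real (rl_kernel \<alpha> \<tau> * exp (- c * \<tau>)) * ((w * of_real \<tau>) ^ n /\<^sub>R fact n)" for n \<tau>
  have kern: "rl_kernel \<alpha> \<tau> * \<tau> ^ n = rl_kernel (\<alpha> + real n) \<tau>" for n \<tau>
    by (cases "\<tau> = 0")
       (auto simp: rl_kernel_def indicator_def powr_add[symmetric] powr_realpow[symmetric] algebra_simps)
  have f_eq: "f n \<tau> = of_real (rl_kernel (\<alpha> + real n) \<tau> * exp (- c * \<tau>)) * (w ^ n / fact n)" for n \<tau>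
    unfolding f_def kern[symmetric]
    by (simp add: power_mult_distrib scaleR_conv_of_real divide_inverse mult_ac)
  define g where "g n = pochhammer \<alpha> n / fact n * c powr (- \<alpha>) * Gamma \<alpha> / c ^ n" for n
  have base: "has_bochner_integral lborel (\<lambda>\<tau>. rl_kernel (\<alpha> + real n) \<tau> * exp (- c * \<tau>)) (g n * fact n)" for n
  proof -
    have "Gamma (\<alpha> + real n) * c powr (- (\<alpha> + real n)) = g n * fact n"
    proof -
      have "c powr (- (\<alpha> + real n)) = c powr (- \<alpha>) / c ^ n"
        using c by (simp add: powr_diff powr_realpow)
      moreover have "Gamma (\<alpha> + real n) = pochhammer \<alpha> n * Gamma \<alpha>"
      proof -
        have "\<alpha> \<notin> \<int>\<^sub>\<le>\<^sub>0" using assms nonpos_Ints_nonpos[of \<alpha>] by auto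
        from pochhammer_Gamma[OF this, of n] show ?thesis
          using Gamma_real_pos[OF assms(1)] by simp
      qed
      ultimately show ?thesis by (simp add: g_def)
    qed
    then show ?thesis
      using laplace_rl_kernel_real[of "\<alpha> + real n" c] assms c by simp
  qed
  have f_int: "has_bochner_integral lborel (f n) (of_real (g n) * w ^ n)" for n
  proof -
    have "has_bochner_integral lborel (\<lambda>\<tau>. of_real (rl_kernel (\<alpha> + real n) \<tau> * exp (- c * \<tau>)) * (w ^ n / fact n))
       (of_real (g n * fact n) * (w ^ n / fact n))"
      by (intro has_bochner_integral_mult_left has_bochner_integral_of_real base)
    then show ?thesis by (simp add: f_eq[abs_def])
  qed
  have norm_int: "(\<integral>\<tau>. norm (f n \<tau>) \<partial>lborel) = g n * cmod w ^ n" for n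
  proof -
    have "(\<integral>\<tau>. norm (f n \<tau>) \<partial>lborel) =
        (\<integral>\<tau>. rl_kernel (\<alpha> + real n) \<tau> * exp (- c * \<tau>) * (cmod w ^ n / fact n) \<partial>lborel)"
      by (simp add: f_eq norm_mult norm_divide norm_power rl_kernel_nonneg)
    also have "\<dots> = g n * cmod w ^ n"
      using has_bochner_integral_integral_eq[OF base[of n]] by simp
    finally show ?thesis .
  qed
  have g_binomial: "of_real (g n) * x ^ n = of_real (c powr (- \<alpha>) * Gamma \<alpha>) * ((- of_real \<alpha> gchoose n) * (- x / of_real c) ^ n)"
    for n and x :: complex
    unfolding gbinomial_minus_times_power by (simp add: g_def)
  have g_binomial_real: "g n * x ^ n = c powr (- \<alpha>) * Gamma \<alpha> * ((- \<alpha> gchoose n) * (- x / c) ^ n)"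
    for n x
    using gbinomial_minus_times_power[of \<alpha> n x c] by (simp add: g_def)
  have "summable (\<lambda>n. g n * cmod w ^ n)"
  proof -
    have "summable (\<lambda>n. (- \<alpha> gchoose n) * (- cmod w / c) ^ n)"
      using gen_binomial_real[of "- cmod w / c" "- \<alpha>"] wc c by (auto simp: sums_iff)
    from summable_mult[OF this, of "c powr (- \<alpha>) * Gamma \<alpha>"] show ?thesis
      by (simp add: g_binomial_real)
  qed
  then have norm_summable: "summable (\<lambda>n. \<integral>\<tau>. norm (f n \<tau>) \<partial>lborel)"
    by (simp add: norm_int)
  have f_norm_summable: "AE \<tau> in lborel. summable (\<lambda>n. norm (f n \<tau>))"
    unfolding f_def norm_mult by (intro AE_I2 summable_mult summable_norm_exp)
  have f_int': "integrable lborel (f n)" for n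
    using f_int[of n] by (simp add: has_bochner_integral_iff)
  have sum_f: "(\<Sum>n. f n \<tau>) = of_real (rl_kernel \<alpha> \<tau>) * exp (- z * of_real \<tau>)" for \<tau>
  proof -
    have "(\<lambda>n. f n \<tau>) sums (of_real (rl_kernel \<alpha> \<tau> * exp (- c * \<tau>)) * exp (w * of_real \<tau>))"
      unfolding f_def by (intro sums_mult exp_converges)
    also have "of_real (rl_kernel \<alpha> \<tau> * exp (- c * \<tau>)) * exp (w * of_real \<tau>)
        = of_real (rl_kernel \<alpha> \<tau>) * exp (- z * of_real \<tau>)"
      by (simp add: w_def exp_of_real[symmetric] mult.assoc exp_add[symmetric] algebra_simps)
    finally show ?thesis by (simp add: sums_iff)
  qed
  have "(\<lambda>n. of_real (g n) * w ^ n) sums (of_real (c powr (- \<alpha>) * Gamma \<alpha>) * (1 + (- w / of_real c)) powr (- of_real \<alpha>))"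
    unfolding g_binomial
    by (intro sums_mult gen_binomial_complex) (use wc c in \<open>simp add: norm_divide\<close>)
  moreover have "1 + (- w / of_real c) = z / of_real c"
    using c by (simp add: w_def field_simps)
  moreover have "of_real (c powr (- \<alpha>)) * (z / of_real c) powr (- of_real \<alpha>) = z powr (- of_real \<alpha>)"
  proof -
    have "z \<noteq> 0" using zpos by auto
    then have "(z / of_real c) powr (- of_real \<alpha>) = exp (- of_real \<alpha> * (Ln z - of_real (ln c)))"
      using c by (simp add: powr_def Ln_divide_of_real)
    moreover have "of_real (c powr (- \<alpha>)) = exp (- of_real \<alpha> * complex_of_real (ln c))"
      using c by (simp add: powr_def exp_of_real[symmetric])
    moreover have "z powr (- of_real \<alpha>) = exp (- of_real \<alpha> * Ln z)"
      using \<open>z \<noteq> 0\<close> by (simp add: powr_def)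
    ultimately show ?thesis
      by (simp add: exp_add[symmetric] right_diff_distrib)
  qed
  ultimately have "(\<lambda>n. of_real (g n) * w ^ n) sums (of_real (Gamma \<alpha>) * z powr (- of_real \<alpha>))"
    by (simp add: mult_ac)
  moreover have "(\<lambda>n. of_real (g n) * w ^ n) sums (\<integral>\<tau>. (\<Sum>n. f n \<tau>) \<partial>lborel)"
    using sums_integral[OF f_int' f_norm_summable norm_summable]
      has_bochner_integral_integral_eq[OF f_int] by simp
  ultimately have "(\<integral>\<tau>. (\<Sum>n. f n \<tau>) \<partial>lborel) = of_real (Gamma \<alpha>) * z powr (- of_real \<alpha>)"
    using sums_unique2 by blast
  then show ?thesis
    using integrable_suminf[OF f_int' f_norm_summable norm_summable]
    by (simp add: has_bochner_integral_iff sum_f)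
qed

section \<open>Convolution along a line\<close>

lemma has_bochner_integral_translate:
  fixes f :: "'e::euclidean_space \<Rightarrow> 'b::{banach, second_countable_topology}"
  assumes "integrable lborel f"
  shows "has_bochner_integral lborel (\<lambda>p. f (p - v)) (integral\<^sup>L lborel f)"
proof -
  have [measurable]: "f \<in> borel_measurable borel" using assms by auto
  have "integrable (distr lborel borel ((+) (- v))) f"
    and "integral\<^sup>L (distr lborel borel ((+) (- v))) f = integral\<^sup>L lborel f"
    using assms by (simp_all only: lborel_distr_plus)
  then show ?thesis
    by (simp add: has_bochner_integral_iff integrable_distr_eq integral_distr)
qed

text \<open>Multiplicativity factors the integrand, \<open>\<psi> p k(\<tau>) U(p - \<tau> c) = k(\<tau>) \<psi>(\<tau> c) (\<psi> U)(p - \<tau> c)\<close>. For fixed \<open>\<tau>\<close> the integral over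
  \<open>p\<close> of the last factor does not depend on \<open>\<tau>\<close>, by translation invariance; this gives both the
  absolute convergence that Fubini's theorem needs and the value of the integral.\<close>
lemma character_integral_line_convolution:
  fixes c :: "'e::euclidean_space" and U \<psi> :: "'e \<Rightarrow> complex" and k :: "real \<Rightarrow> complex"
  assumes [measurable]: "U \<in> borel_measurable borel" "\<psi> \<in> borel_measurable borel" "k \<in> borel_measurable borel"
    and \<psi>_add: "\<And>p q. \<psi> (p + q) = \<psi> p * \<psi> q"
    and \<psi>U: "integrable lborel (\<lambda>p. \<psi> p * U p)"
    and k\<psi>: "integrable lborel (\<lambda>\<tau>. k \<tau> * \<psi> (\<tau> *\<^sub>R c))"
  shows "has_bochner_integral lborel (\<lambda>p. \<psi> p * (\<integral>\<tau>. k \<tau> * U (p - \<tau> *\<^sub>R c) \<partial>lborel))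
           ((\<integral>\<tau>. k \<tau> * \<psi> (\<tau> *\<^sub>R c) \<partial>lborel) * (\<integral>p. \<psi> p * U p \<partial>lborel))"
proof -
  define f where "f \<tau> p = \<psi> p * (k \<tau> * U (p - \<tau> *\<^sub>R c))" for \<tau> p
  have f_eq: "f \<tau> p = (k \<tau> * \<psi> (\<tau> *\<^sub>R c)) * (\<psi> (p - \<tau> *\<^sub>R c) * U (p - \<tau> *\<^sub>R c))" for \<tau> p
    using \<psi>_add[of "\<tau> *\<^sub>R c" "p - \<tau> *\<^sub>R c"] by (simp add: f_def)
  have f_meas: "case_prod f \<in> borel_measurable (lborel \<Otimes>\<^sub>M lborel)"
    unfolding f_def[abs_def] by measurable
  have inner: "has_bochner_integral lborel (f \<tau>) ((k \<tau> * \<psi> (\<tau> *\<^sub>R c)) * (\<integral>p. \<psi> p * U p \<partial>lborel))" for \<tau>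
    unfolding f_eq
    by (intro has_bochner_integral_mult_right has_bochner_integral_translate[OF \<psi>U])
  have inner_norm: "(\<integral>p. norm (f \<tau> p) \<partial>lborel) = norm (k \<tau> * \<psi> (\<tau> *\<^sub>R c)) * (\<integral>p. norm (\<psi> p * U p) \<partial>lborel)" for \<tau>
    unfolding f_eq norm_mult[of "k \<tau> * \<psi> (\<tau> *\<^sub>R c)"]
    by (intro has_bochner_integral_integral_eq has_bochner_integral_mult_right
        has_bochner_integral_translate[OF integrable_norm[OF \<psi>U]])
  have f_int: "integrable (lborel \<Otimes>\<^sub>M lborel) (case_prod f)"
  proof (rule lborel_pair.Fubini_integrable[OF f_meas])
    show "integrable lborel (\<lambda>\<tau>. \<integral>p. norm (case (\<tau>, p) of (\<tau>, p) \<Rightarrow> f \<tau> p) \<partial>lborel)"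
      using k\<psi> by (simp add: inner_norm)
    show "AE \<tau> in lborel. integrable lborel (\<lambda>p. case (\<tau>, p) of (\<tau>, p) \<Rightarrow> f \<tau> p)"
      using inner by (simp add: has_bochner_integral_iff)
  qed
  have eq: "(\<lambda>p. \<integral>\<tau>. f \<tau> p \<partial>lborel) = (\<lambda>p. \<psi> p * (\<integral>\<tau>. k \<tau> * U (p - \<tau> *\<^sub>R c) \<partial>lborel))"
    by (simp add: f_def)
  have "(\<integral>p. (\<integral>\<tau>. f \<tau> p \<partial>lborel) \<partial>lborel) = (\<integral>\<tau>. (\<integral>p. f \<tau> p \<partial>lborel) \<partial>lborel)"
    by (rule lborel_pair.Fubini_integral[OF f_int])
  also have "\<dots> = (\<integral>\<tau>. k \<tau> * \<psi> (\<tau> *\<^sub>R c) \<partial>lborel) * (\<integral>p. \<psi> p * U p \<partial>lborel)"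
    using has_bochner_integral_integral_eq[OF inner] by simp
  finally show ?thesis
    using lborel_pair.integrable_snd[OF f_int] by (simp add: has_bochner_integral_iff eq)
qed

section \<open>The fractional integral along the line of transport\<close>

text \<open>Up to the factor \<open>1 / \<Gamma>(\<alpha>)\<close>, the Riemann-Liouville integral of \<open>U\<close> along the ray that runs from \<open>p\<close> backwards in direction
  \<open>c\<close>. For \<open>c = (b, 1)\<close> and \<open>U\<close> vanishing at negative times, the ray is the past of a particle that moves with
  velocity \<open>b\<close>, and only its part in nonnegative times counts.\<close>
definition rl_transport :: "real \<Rightarrow> 'e::real_normed_vector \<Rightarrow> ('e \<Rightarrow> real) \<Rightarrow> 'e \<Rightarrow> real" where
  "rl_transport \<alpha> c U p = (\<integral>\<tau>. rl_kernel \<alpha> \<tau> * U (p - \<tau> *\<^sub>R c) \<partial>lborel)"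

context
  fixes U :: "'a::euclidean_space \<times> real \<Rightarrow> real" and b :: 'a and \<alpha> M a :: real
  assumes \<alpha>: "0 < \<alpha>"
    and U_meas [measurable]: "U \<in> borel_measurable borel"
    and U_neg: "\<And>x t. t < 0 \<Longrightarrow> U (x, t) = 0"
    and U_bound: "\<And>x t. t \<ge> 0 \<Longrightarrow> \<bar>U (x, t)\<bar> \<le> M * exp (a * t)"
    and U_cont: "\<And>t. continuous_on UNIV (\<lambda>x. U (x, t))"
begin

lemma bound_nonneg: "0 \<le> M"
  using order_trans[OF abs_ge_zero U_bound[of 0]] by simp

lemma U_bound_upto: "\<bar>U (x, t)\<bar> \<le> M * exp (\<bar>a\<bar> * T)" if "t \<le> T"
proof (cases "t \<ge> 0")
  case True
  show ?thesis
  proof -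
    have "a * t \<le> \<bar>a\<bar> * T"
      using True that by (intro mult_mono) auto
    then have "M * exp (a * t) \<le> M * exp (\<bar>a\<bar> * T)"
      using bound_nonneg by (intro mult_left_mono) auto
    with U_bound[OF True, of x] show ?thesis by linarith
  qed
qed (simp add: U_neg bound_nonneg)

lemma integrable_rl_kernel_upto: "integrable lborel (\<lambda>\<tau>. indicator {..T} \<tau> * rl_kernel \<alpha> \<tau>)"
proof (rule Bochner_Integration.integrable_bound)
  show "integrable lborel (\<lambda>\<tau>. exp T * (rl_kernel \<alpha> \<tau> * exp (- 1 * \<tau>)))"
    using laplace_rl_kernel_real[OF \<alpha>, of 1] by (simp add: has_bochner_integral_iff)
  show "AE \<tau> in lborel. norm (indicator {..T} \<tau> * rl_kernel \<alpha> \<tau>) \<le> norm (exp T * (rl_kernel \<alpha> \<tau> * exp (- 1 * \<tau>)))"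
  proof (rule AE_I2)
    fix \<tau>
    have "rl_kernel \<alpha> \<tau> \<le> exp T * (rl_kernel \<alpha> \<tau> * exp (- 1 * \<tau>))" if "\<tau> \<le> T"
      using mult_left_mono[of 1 "exp (T - \<tau>)" "rl_kernel \<alpha> \<tau>"] that
      by (simp add: rl_kernel_nonneg exp_diff exp_minus field_simps)
    then show "norm (indicator {..T} \<tau> * rl_kernel \<alpha> \<tau>) \<le> norm (exp T * (rl_kernel \<alpha> \<tau> * exp (- 1 * \<tau>)))"
      by (auto simp: indicator_def rl_kernel_nonneg)
  qed
qed measurable

text \<open>Stated for every kernel \<open>k\<close> below the Riemann-Liouville kernel, because it is used for the kernel itself and for its
  truncation error.\<close>
lemma rl_transport_integrand_bound:
  assumes "t \<le> T" and k: "0 \<le> k" "k \<le> rl_kernel \<alpha> \<tau>"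
  shows "\<bar>k * U ((x, t) - \<tau> *\<^sub>R (b, 1))\<bar> \<le> M * exp (\<bar>a\<bar> * T) * (indicator {..T} \<tau> * k)"
proof (cases "\<tau> \<ge> 0 \<and> \<tau> \<le> T")
  case True
  with U_bound_upto[of "t - \<tau>" T "x - \<tau> *\<^sub>R b"] assms show ?thesis
    by (auto simp: abs_mult mult.commute[of k] intro!: mult_right_mono)
next
  case False
  then consider "\<tau> < 0" | "\<tau> > T" by linarith
  then show ?thesis
  proof cases
    case 1
    then have "k = 0" using k by (simp add: rl_kernel_def)
    then show ?thesis by simp
  qed (use assms in \<open>simp add: U_neg\<close>)
qed

lemma integrable_rl_transport:
  "integrable lborel (\<lambda>\<tau>. rl_kernel \<alpha> \<tau> * U ((x, t) - \<tau> *\<^sub>R (b, 1)))"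
proof (rule Bochner_Integration.integrable_bound)
  show "integrable lborel (\<lambda>\<tau>. M * exp (\<bar>a\<bar> * t) * (indicator {..t} \<tau> * rl_kernel \<alpha> \<tau>))"
    by (intro integrable_mult_right integrable_rl_kernel_upto)
  show "AE \<tau> in lborel. norm (rl_kernel \<alpha> \<tau> * U ((x, t) - \<tau> *\<^sub>R (b, 1)))
      \<le> norm (M * exp (\<bar>a\<bar> * t) * (indicator {..t} \<tau> * rl_kernel \<alpha> \<tau>))"
    using rl_transport_integrand_bound[of t t "rl_kernel \<alpha> \<tau>" \<tau> x for \<tau>]
    by (intro AE_I2) (simp add: rl_kernel_nonneg bound_nonneg abs_mult)
qed measurable

text \<open>For \<open>\<alpha> < 1\<close> the kernel is unbounded near \<open>\<tau> = 0\<close>, so its translates have no common integrable bound; those of the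
  kernel truncated at \<open>n\<close> do on bounded intervals, and dominated convergence applies.\<close>
definition truncated_transport :: "nat \<Rightarrow> 'a \<times> real \<Rightarrow> real" where
  "truncated_transport n p = (\<integral>\<tau>. min (rl_kernel \<alpha> \<tau>) (real n) * U (p - \<tau> *\<^sub>R (b, 1)) \<partial>lborel)"

lemma isCont_min_rl_kernel: "isCont (\<lambda>\<tau>. min (rl_kernel \<alpha> \<tau>) r) \<tau>" if "\<tau> \<noteq> 0"
proof -
  have "isCont (rl_kernel \<alpha>) \<tau>"
  proof (cases "\<tau> > 0")
    case True
    have "\<forall>\<^sub>F \<tau>' in nhds \<tau>. rl_kernel \<alpha> \<tau>' = \<tau>' powr (\<alpha> - 1)"
      using eventually_nhds_in_open[of "{0<..}" \<tau>] True
      by (auto simp: rl_kernel_def elim!: eventually_mono)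
    moreover have "isCont (\<lambda>\<tau>'. \<tau>' powr (\<alpha> - 1)) \<tau>"
      using True by (intro continuous_intros) auto
    ultimately show ?thesis using isCont_cong by fastforce
  next
    case False
    have "\<forall>\<^sub>F \<tau>' in nhds \<tau>. rl_kernel \<alpha> \<tau>' = 0"
      using eventually_nhds_in_open[of "{..<0}" \<tau>] False that
      by (auto simp: rl_kernel_def elim!: eventually_mono)
    then show ?thesis using isCont_cong[of "rl_kernel \<alpha>" "\<lambda>_. 0" \<tau>] by simp
  qed
  then show ?thesis by (intro continuous_intros)
qed

text \<open>With the past time \<open>r = t - \<tau>\<close> as variable of integration, \<open>x\<close> and \<open>t\<close> enter only through the kernel and
  the spatial argument of \<open>U\<close>, and not through its time argument, in which \<open>U\<close> need not be continuous.\<close>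
lemma truncated_transport_eq_past:
  "truncated_transport n (x, t) = (\<integral>r. min (rl_kernel \<alpha> (t - r)) (real n) * U (x - (t - r) *\<^sub>R b, r) \<partial>lborel)"
  unfolding truncated_transport_def by (subst lborel_integral_real_affine[of "-1" _ t]) auto

lemma isCont_truncated_transport: "isCont (truncated_transport n) p"
  unfolding continuous_at_sequentially
proof (intro allI impI)
  fix P :: "nat \<Rightarrow> 'a \<times> real" assume P: "P \<longlonglongrightarrow> p"
  obtain x t where p: "p = (x, t)" by (cases p)
  define X R where "X m = fst (P m)" and "R m = snd (P m)" for m
  have PXR: "P m = (X m, R m)" for m by (simp add: X_def R_def)
  have X: "X \<longlonglongrightarrow> x" and R: "R \<longlonglongrightarrow> t"
    unfolding X_def[abs_def] R_def[abs_def] using tendsto_fst[OF P] tendsto_snd[OF P] by (simp_all add: p)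
  from R have "Bseq R" by (rule convergent_imp_Bseq[OF convergentI])
  then obtain T where T: "\<And>m. \<bar>R m\<bar> \<le> T" by (auto simp: Bseq_def)
  define f where "f x t r = min (rl_kernel \<alpha> (t - r)) (real n) * U (x - (t - r) *\<^sub>R b, r)" for x t r
  have f_meas [measurable]: "f x t \<in> borel_measurable borel" for x t
    unfolding f_def[abs_def] by measurable
  have "(\<lambda>m. \<integral>r. f (X m) (R m) r \<partial>lborel) \<longlonglongrightarrow> (\<integral>r. f x t r \<partial>lborel)"
  proof (rule integral_dominated_convergence)
    show "integrable lborel (\<lambda>r. indicator {0..T} r * (real n * (M * exp (\<bar>a\<bar> * T))))"
      by (intro integrable_mult_left integrable_real_indicator) (auto simp: emeasure_lborel_Icc_eq)
    show "AE r in lborel. norm (f (X m) (R m) r) \<le> indicator {0..T} r * (real n * (M * exp (\<bar>a\<bar> * T)))" for m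
    proof (rule AE_I2)
      fix r
      consider "r < 0" | "r > T" | "0 \<le> r" "r \<le> T" by linarith
      then show "norm (f (X m) (R m) r) \<le> indicator {0..T} r * (real n * (M * exp (\<bar>a\<bar> * T)))"
      proof cases
        case 1
        then show ?thesis by (simp add: f_def U_neg)
      next
        case 2
        then show ?thesis using T[of m] by (simp add: f_def rl_kernel_def)
      next
        case 3
        have "\<bar>min (rl_kernel \<alpha> (R m - r)) (real n)\<bar> \<le> real n"
          using rl_kernel_nonneg[of \<alpha> "R m - r"] by auto
        then show ?thesis
          using 3 U_bound_upto[OF 3(2)] by (auto simp: f_def abs_mult intro!: mult_mono)
      qed
    qed
    \<comment> \<open>The truncated kernel may jump at \<open>0\<close>, so the integrand may fail to converge at \<open>r = t\<close>.\<close>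
    have "AE r in lborel. r \<noteq> t" by (rule AE_lborel_singleton)
    then show "AE r in lborel. (\<lambda>m. f (X m) (R m) r) \<longlonglongrightarrow> f x t r"
    proof eventually_elim
      fix r assume "r \<noteq> t"
      have "(\<lambda>m. min (rl_kernel \<alpha> (R m - r)) (real n)) \<longlonglongrightarrow> min (rl_kernel \<alpha> (t - r)) (real n)"
        using isCont_tendsto_compose[OF isCont_min_rl_kernel tendsto_diff[OF R tendsto_const]] \<open>r \<noteq> t\<close> by simp
      moreover have "(\<lambda>m. U (X m - (R m - r) *\<^sub>R b, r)) \<longlonglongrightarrow> U (x - (t - r) *\<^sub>R b, r)"
        by (rule continuous_on_tendsto_compose[OF U_cont]) (auto intro!: tendsto_intros X R)
      ultimately show "(\<lambda>m. f (X m) (R m) r) \<longlonglongrightarrow> f x t r"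
        unfolding f_def by (rule tendsto_mult)
    qed
  qed auto
  then show "(truncated_transport n \<circ> P) \<longlonglongrightarrow> truncated_transport n p"
    by (simp add: o_def PXR p truncated_transport_eq_past f_def)
qed

text \<open>Where time is bounded by \<open>T\<close> the error is at most the bound for \<open>U\<close> times the integral over \<open>(0, T]\<close> of the part of the kernel
  above \<open>n\<close>, which tends to zero because the kernel is integrable there.\<close>
lemma truncated_transport_uniform_limit:
  "uniform_limit {p. snd p \<le> T} truncated_transport (rl_transport \<alpha> (b, 1) U) sequentially"
proof -
  define C where "C = M * exp (\<bar>a\<bar> * T)"
  define e where "e n = (\<integral>\<tau>. indicator {..T} \<tau> * (rl_kernel \<alpha> \<tau> - min (rl_kernel \<alpha> \<tau>) (real n)) \<partial>lborel)" for n
  have e_int: "integrable lborel (\<lambda>\<tau>. indicator {..T} \<tau> * (rl_kernel \<alpha> \<tau> - min (rl_kernel \<alpha> \<tau>) (real n)))" for n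
    by (rule Bochner_Integration.integrable_bound[OF integrable_rl_kernel_upto[of T]])
       (auto simp: indicator_def rl_kernel_nonneg)
  have "e \<longlonglongrightarrow> (\<integral>\<tau>. 0 \<partial>(lborel :: real measure))"
    unfolding e_def[abs_def]
  proof (rule integral_dominated_convergence[OF _ _ integrable_rl_kernel_upto[of T]])
    show "AE \<tau> in lborel. (\<lambda>n. indicator {..T} \<tau> * (rl_kernel \<alpha> \<tau> - min (rl_kernel \<alpha> \<tau>) (real n))) \<longlonglongrightarrow> 0"
    proof (rule AE_I2)
      fix \<tau>
      obtain n0 :: nat where "rl_kernel \<alpha> \<tau> \<le> real n0" using real_arch_simple by blast
      then have "\<forall>\<^sub>F n in sequentially. indicator {..T} \<tau> * (rl_kernel \<alpha> \<tau> - min (rl_kernel \<alpha> \<tau>) (real n)) = 0"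
        by (intro eventually_sequentiallyI[of n0]) auto
      then show "(\<lambda>n. indicator {..T} \<tau> * (rl_kernel \<alpha> \<tau> - min (rl_kernel \<alpha> \<tau>) (real n))) \<longlonglongrightarrow> 0"
        by (rule tendsto_eventually)
    qed
  qed (auto simp: indicator_def rl_kernel_nonneg)
  then have Ce: "(\<lambda>n. C * e n) \<longlonglongrightarrow> 0"
    using tendsto_mult_right_zero by fastforce
  have bound: "\<bar>rl_transport \<alpha> (b, 1) U p - truncated_transport n p\<bar> \<le> C * e n" if "snd p \<le> T" for n p
  proof -
    obtain x t where p: "p = (x, t)" by (cases p)
    define k where "k \<tau> = rl_kernel \<alpha> \<tau> - min (rl_kernel \<alpha> \<tau>) (real n)" for \<tau>
    have k: "0 \<le> k \<tau>" "k \<tau> \<le> rl_kernel \<alpha> \<tau>" for \<tau>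
      using rl_kernel_nonneg[of \<alpha> \<tau>] by (auto simp: k_def)
    have [measurable]: "k \<in> borel_measurable borel" unfolding k_def[abs_def] by measurable
    have int1: "integrable lborel (\<lambda>\<tau>. rl_kernel \<alpha> \<tau> * U (p - \<tau> *\<^sub>R (b, 1)))"
      unfolding p by (rule integrable_rl_transport)
    have kU: "\<bar>k \<tau> * U (p - \<tau> *\<^sub>R (b, 1))\<bar> \<le> C * (indicator {..T} \<tau> * k \<tau>)" for \<tau>
      using rl_transport_integrand_bound[OF _ k, where t = t and T = T and x = x] that by (simp add: p C_def)
    have int_k: "integrable lborel (\<lambda>\<tau>. k \<tau> * U (p - \<tau> *\<^sub>R (b, 1)))"
      by (rule Bochner_Integration.integrable_bound[OF integrable_mult_right[OF e_int, of C n]])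
         (use kU in \<open>auto simp: k_def intro!: AE_I2 order_trans[OF _ abs_ge_self]\<close>)
    have "min (rl_kernel \<alpha> \<tau>) (real n) * U (p - \<tau> *\<^sub>R (b, 1))
        = rl_kernel \<alpha> \<tau> * U (p - \<tau> *\<^sub>R (b, 1)) - k \<tau> * U (p - \<tau> *\<^sub>R (b, 1))" for \<tau>
      by (simp add: k_def algebra_simps)
    then have "rl_transport \<alpha> (b, 1) U p - truncated_transport n p = (\<integral>\<tau>. k \<tau> * U (p - \<tau> *\<^sub>R (b, 1)) \<partial>lborel)"
      using int1 int_k by (simp add: rl_transport_def truncated_transport_def)
    also have "\<bar>\<dots>\<bar> \<le> (\<integral>\<tau>. \<bar>k \<tau> * U (p - \<tau> *\<^sub>R (b, 1))\<bar> \<partial>lborel)"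
      by (rule integral_abs_bound)
    also have "\<dots> \<le> (\<integral>\<tau>. C * (indicator {..T} \<tau> * k \<tau>) \<partial>lborel)"
      using kU int_k e_int[of n] by (intro integral_mono) (auto simp: k_def)
    also have "\<dots> = C * e n" by (simp add: e_def k_def)
    finally show ?thesis .
  qed
  show ?thesis
  proof (rule uniform_limitI)
    fix \<epsilon> :: real assume "\<epsilon> > 0"
    with Ce have "\<forall>\<^sub>F n in sequentially. C * e n < \<epsilon>" by (rule order_tendstoD)
    then show "\<forall>\<^sub>F n in sequentially. \<forall>p\<in>{p. snd p \<le> T}. dist (truncated_transport n p) (rl_transport \<alpha> (b, 1) U p) < \<epsilon>"
    proof eventually_elim
      fix n assume n: "C * e n < \<epsilon>"
      show "\<forall>p\<in>{p. snd p \<le> T}. dist (truncated_transport n p) (rl_transport \<alpha> (b, 1) U p) < \<epsilon>"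
      proof
        fix p :: "'a \<times> real" assume "p \<in> {p. snd p \<le> T}"
        then show "dist (truncated_transport n p) (rl_transport \<alpha> (b, 1) U p) < \<epsilon>"
          using bound[of p n] n by (simp add: dist_real_def abs_minus_commute)
      qed
    qed
  qed
qed

lemma continuous_rl_transport: "continuous_on UNIV (rl_transport \<alpha> (b, 1) U)"
proof (rule continuous_at_imp_continuous_on, rule ballI)
  fix p :: "'a \<times> real"
  have op: "open {q :: 'a \<times> real. snd q < snd p + 1}"
    by (intro open_Collect_less continuous_intros)
  have "continuous_on {q. snd q < snd p + 1} (rl_transport \<alpha> (b, 1) U)"
  proof (rule uniform_limit_theorem)
    show "uniform_limit {q. snd q < snd p + 1} truncated_transport (rl_transport \<alpha> (b, 1) U) sequentially"
      by (rule uniform_limit_on_subset[OF truncated_transport_uniform_limit[of "snd p + 1"]]) auto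
    show "\<forall>\<^sub>F n in sequentially. continuous_on {q. snd q < snd p + 1} (truncated_transport n)"
      by (intro always_eventually allI continuous_at_imp_continuous_on ballI isCont_truncated_transport)
  qed auto
  then show "isCont (rl_transport \<alpha> (b, 1) U) p"
    using op by (auto simp: continuous_on_eq_continuous_at simp del: split_paired_All)
qed

end

text \<open>Along the line in direction \<open>(b, 1)\<close> the character is \<open>exp (- (s - \<i> b \<bullet> \<xi>) \<tau>)\<close>, so the line integral of the
  kernel is its Laplace transform at \<open>s - \<i> b \<bullet> \<xi>\<close>.\<close>
lemma has_bochner_integral_rl_transport:
  fixes U :: "'a::euclidean_space \<times> real \<Rightarrow> real"
  assumes \<alpha>: "0 < \<alpha>" and s: "0 < Re s"
    and U [measurable]: "U \<in> borel_measurable borel"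
    and transform: "has_bochner_integral lborel (\<lambda>p. fl_character \<xi> s p * of_real (U p)) I"
  shows "has_bochner_integral lborel (\<lambda>p. fl_character \<xi> s p * of_real (rl_transport \<alpha> (b, 1) U p))
           (of_real (Gamma \<alpha>) * (s - \<i> * of_real (b \<bullet> \<xi>)) powr (- of_real \<alpha>) * I)"
proof -
  define z where "z = s - \<i> * of_real (b \<bullet> \<xi>)"
  have z: "0 < Re z" using s by (simp add: z_def)
  have char: "fl_character \<xi> s (\<tau> *\<^sub>R b, \<tau>) = exp (- (z * of_real \<tau>))" for \<tau>
    by (simp add: fl_character_def z_def inner_commute algebra_simps)
  note laplace = laplace_rl_kernel[OF \<alpha> z, unfolded has_bochner_integral_iff]
  have "has_bochner_integral lborel
      (\<lambda>p. fl_character \<xi> s p * (\<integral>\<tau>. of_real (rl_kernel \<alpha> \<tau>) * of_real (U (p - \<tau> *\<^sub>R (b, 1))) \<partial>lborel))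
      ((\<integral>\<tau>. of_real (rl_kernel \<alpha> \<tau>) * fl_character \<xi> s (\<tau> *\<^sub>R (b, 1)) \<partial>lborel) *
       (\<integral>p. fl_character \<xi> s p * of_real (U p) \<partial>lborel))"
    using transform laplace
    by (intro character_integral_line_convolution) (auto simp: char fl_character_add has_bochner_integral_iff)
  moreover have "(\<integral>\<tau>. of_real (rl_kernel \<alpha> \<tau>) * of_real (U (p - \<tau> *\<^sub>R (b, 1))) \<partial>lborel)
      = complex_of_real (rl_transport \<alpha> (b, 1) U p)" for p
    unfolding rl_transport_def by (simp flip: of_real_mult)
  ultimately show ?thesis
    using transform laplace unfolding z_def[symmetric] by (simp add: char has_bochner_integral_iff)
qed

section \<open>The pointwise representation\<close>

lemma schwartz_space_continuous:
  assumes "f \<in> schwartz_space"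
  shows "continuous_on UNIV f"
proof -
  have "iterated_partial_deriv [] f differentiable at x" for x
    using assms unfolding schwartz_space_def by force
  then show ?thesis
    by (auto simp: iterated_partial_deriv_def intro!: continuous_at_imp_continuous_on differentiable_imp_continuous_within)
qed

lemma schwartz_space_bdd_above:
  assumes "f \<in> schwartz_space"
  shows "bdd_above (range (\<lambda>x. \<bar>f x\<bar>))"
proof -
  have "\<forall>k. bounded (range (\<lambda>x. (\<Prod>i\<in>Basis. (x \<bullet> i) ^ k i) * iterated_partial_deriv [] f x))"
    using assms by (auto simp: schwartz_space_def dest: spec[of _ "[]"])
  from spec[OF this, of "\<lambda>_. 0"]
  have "bounded (range f)" by (simp add: iterated_partial_deriv_def)
  then show ?thesis
    by (auto simp: bounded_iff bdd_above_def)
qed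

theorem proposition4:
  fixes u :: "'a::euclidean_space \<Rightarrow> real \<Rightarrow> real" and b :: 'a and \<alpha> M a :: real
  assumes "b \<in> sphere 0 1"
    and "0 < \<alpha>" and "\<alpha> < 1"
    and "\<And>t. t \<ge> 0 \<Longrightarrow> (\<lambda>x. u x t) \<in> schwartz_space"
    and "M > 0"
    and "\<And>t. t \<ge> 0 \<Longrightarrow> (SUP x. \<bar>u x t\<bar>) \<le> M * exp (a * t)"
    and "\<exists>\<sigma>. fourier_laplace_converges (\<lambda>x t. complex_of_real (u x t)) \<sigma>"
  shows "let v = (\<lambda>x t. complex_of_real (1 / Gamma \<alpha> *
               (LINT s:{0..t}|lebesgue. (t - s) powr (\<alpha> - 1) * u (x - (t - s) *\<^sub>R b) s)))
         in (\<forall>x. \<forall>t\<ge>0. (\<lambda>s. (t - s) powr (\<alpha> - 1) * u (x - (t - s) *\<^sub>R b) s)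
               absolutely_integrable_on {0..t}) \<and>
            is_fractional_material_integral \<alpha> b (\<lambda>x t. complex_of_real (u x t)) v \<and>
            (\<forall>w. is_fractional_material_integral \<alpha> b (\<lambda>x t. complex_of_real (u x t)) w \<longrightarrow>
               (AE (x, t) in lebesgue. t \<ge> 0 \<longrightarrow> w x t = v x t) \<and>
               (continuous_on (UNIV \<times> {0..}) (\<lambda>(x, t). w x t) \<longrightarrow>
                  (\<forall>x. \<forall>t\<ge>0. w x t = v x t)))"
proof -
  let ?u = "\<lambda>x t. complex_of_real (u x t)"
  obtain \<sigma>\<^sub>0 where \<sigma>\<^sub>0: "fourier_laplace_converges ?u \<sigma>\<^sub>0" using assms(7) by auto
  \<comment> \<open>The abscissa must be positive for the kernel \<open>\<tau> powr (\<alpha> - 1)\<close> to have a Laplace transform.\<close>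
  define \<sigma> where "\<sigma> = max \<sigma>\<^sub>0 1"
  have \<sigma>: "0 < \<sigma>" and u_conv: "fourier_laplace_converges ?u \<sigma>"
    using fourier_laplace_converges_mono[OF \<sigma>\<^sub>0, of \<sigma>] by (simp_all add: \<sigma>_def)
  have u_cont: "continuous_on UNIV (\<lambda>x. u x t)" if "t \<ge> 0" for t
    using assms(4)[OF that] by (rule schwartz_space_continuous)
  have u_bound: "\<bar>u x t\<bar> \<le> M * exp (a * t)" if "t \<ge> 0" for x t
    using cSUP_upper[OF UNIV_I schwartz_space_bdd_above[OF assms(4)[OF that]]] assms(6)[OF that]
    by (rule order_trans)

  obtain N where N: "N \<in> null_sets lborel"
    and U_meas: "(\<lambda>p. indicator ({0..} - N) (snd p) * u (fst p) (snd p)) \<in> borel_measurable borel"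
    using ex_borel_modification[OF measurable_if_fourier_laplace_converges[OF u_conv] u_cont] by blast
  define U where "U p = indicator ({0..} - N) (snd p) * u (fst p) (snd p)" for p
  have U_meas [measurable]: "U \<in> borel_measurable borel"
    unfolding U_def[abs_def] by (rule U_meas)
  have U_neg: "U (x, t) = 0" if "t < 0" for x t
    using that by (simp add: U_def)
  have U_bound: "\<bar>U (x, t)\<bar> \<le> M * exp (a * t)" if "t \<ge> 0" for x t
    using u_bound[OF that, of x] assms(5) by (simp add: U_def indicator_def)
  have U_cont: "continuous_on UNIV (\<lambda>x. U (x, t))" for t
    using u_cont[of t] by (cases "t \<ge> 0") (auto simp: U_def intro!: continuous_intros)
  have N_AE: "AE t in lborel. t \<notin> N" using N by (rule AE_not_in)
  have U_AE: "AE p in lborel. indicator {0..} (snd p) *\<^sub>R ?u (fst p) (snd p) = complex_of_real (U p)"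
  proof -
    have "N \<in> sets borel" using N by auto
    then have "AE p in lborel \<Otimes>\<^sub>M lborel. snd (p :: 'a \<times> real) \<notin> N"
    proof (subst lborel_pair.AE_pair_iff[where P = "\<lambda>_ t. t \<notin> N", symmetric])
      have "{p \<in> space (lborel \<Otimes>\<^sub>M lborel). snd p \<notin> N} = (UNIV :: 'a set) \<times> (- N)"
        by (auto simp: space_pair_measure)
      also have "\<dots> \<in> sets (lborel \<Otimes>\<^sub>M lborel)"
        using \<open>N \<in> sets borel\<close> by (intro pair_measureI) auto
      finally show "{p \<in> space (lborel \<Otimes>\<^sub>M lborel). snd (p :: 'a \<times> real) \<notin> N} \<in> sets (lborel \<Otimes>\<^sub>M lborel)" .
    qed (use N_AE in auto)
    then have "AE p in lborel. snd (p :: 'a \<times> real) \<notin> N"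
      unfolding lborel_prod .
    then show ?thesis
      by eventually_elim (simp add: U_def indicator_def)
  qed
  define V where "V = rl_transport \<alpha> (b, 1) U"
  have V_cont: "continuous_on UNIV V"
    unfolding V_def using assms(2) U_meas U_neg U_bound U_cont by (rule continuous_rl_transport)
  have V_neg: "V (x, t) = 0" if "t < 0" for x t
  proof -
    have "rl_kernel \<alpha> \<tau> * U ((x, t) - \<tau> *\<^sub>R (b, 1)) = 0" for \<tau>
      using that U_neg[of "t - \<tau>"] by (simp add: rl_kernel_def indicator_def)
    then show ?thesis by (simp only: V_def rl_transport_def Bochner_Integration.integral_zero)
  qed

  define v where "v x t = complex_of_real (1 / Gamma \<alpha> *
               (LINT s:{0..t}|lebesgue. (t - s) powr (\<alpha> - 1) * u (x - (t - s) *\<^sub>R b) s))" for x t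
  have v_integral: "has_bochner_integral lebesgue
      (\<lambda>s. indicator {0..t} s *\<^sub>R ((t - s) powr (\<alpha> - 1) * u (x - (t - s) *\<^sub>R b) s)) (V (x, t))" for x t
  proof (subst has_bochner_integral_completion_iff)
    define f where "f \<tau> = rl_kernel \<alpha> \<tau> * U ((x, t) - \<tau> *\<^sub>R (b, 1))" for \<tau>
    have "has_bochner_integral lborel f (V (x, t))"
      using integrable_rl_transport[OF assms(2) U_meas U_neg U_bound U_cont, of x t b]
      by (simp add: has_bochner_integral_iff V_def rl_transport_def f_def[abs_def])
    then show "has_bochner_integral lborel (\<lambda>s. f (t + - 1 * s)) (V (x, t))"
      by (subst (asm) lborel_has_bochner_integral_real_affine_iff[of "- 1" _ _ t]) simp_all
    show "(\<lambda>s. f (t + - 1 * s)) \<in> borel_measurable lborel"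
      unfolding f_def by measurable
    \<comment> \<open>A line with nonzero time component meets the removed slices only at times in the null set \<open>N\<close>.\<close>
    show "AE s in lborel. indicator {0..t} s *\<^sub>R ((t - s) powr (\<alpha> - 1) * u (x - (t - s) *\<^sub>R b) s) = f (t + - 1 * s)"
      using N_AE by eventually_elim (auto simp: f_def U_def rl_kernel_def indicator_def)
  qed
  have v_eq: "v x t = of_real (V (x, t) / Gamma \<alpha>)" for x t
    using has_bochner_integral_integral_eq[OF v_integral, of t x]
    by (simp add: v_def set_lebesgue_integral_def)
  have v_AE: "AE p in lborel. indicator {0..} (snd p) *\<^sub>R v (fst p) (snd p) = complex_of_real (V p / Gamma \<alpha>)"
    by (intro AE_I2) (auto simp: v_eq V_neg indicator_def)
  have V_meas: "(\<lambda>p. complex_of_real (V p / Gamma \<alpha>)) \<in> borel_measurable borel"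
    using borel_measurable_continuous_onI[OF V_cont] by measurable

  have Gamma: "Gamma \<alpha> \<noteq> 0" using Gamma_real_pos[OF assms(2)] by simp
  have V_transform: "has_bochner_integral lborel (\<lambda>p. fl_character \<xi> s p * of_real (V p / Gamma \<alpha>))
      ((s - \<i> * of_real (b \<bullet> \<xi>)) powr (- of_real \<alpha>) * fourier_laplace ?u \<xi> s)" if "\<sigma> \<le> Re s" for \<xi> s
  proof -
    have "has_bochner_integral lborel (\<lambda>p. fl_character \<xi> s p * of_real (U p)) (fourier_laplace ?u \<xi> s)"
      using U_AE u_conv that by (intro has_bochner_integral_fourier_laplace) auto
    from has_bochner_integral_divide_zero[OF has_bochner_integral_rl_transport[OF assms(2) _ U_meas this, of b],
        of "of_real (Gamma \<alpha>)"]
    show ?thesis using that \<sigma> Gamma by (simp add: V_def)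
  qed
  have v_conv: "fourier_laplace_converges v \<sigma>"
    unfolding fourier_laplace_converges_borel_iff[OF V_meas v_AE]
    using V_transform[of "of_real \<sigma>" 0] by (simp add: has_bochner_integral_iff)
  have v_transform: "fourier_laplace v \<xi> s = (s - \<i> * of_real (b \<bullet> \<xi>)) powr (- of_real \<alpha>) * fourier_laplace ?u \<xi> s"
    if "\<sigma> \<le> Re s" for \<xi> s
    using has_bochner_integral_fourier_laplace[OF V_meas v_AE v_conv that] V_transform[OF that]
    by (rule has_bochner_integral_eq)

  have "(\<lambda>s. (t - s) powr (\<alpha> - 1) * u (x - (t - s) *\<^sub>R b) s) absolutely_integrable_on {0..t}" for x t
    using v_integral[of t x] by (simp add: set_integrable_def has_bochner_integral_iff)
  moreover have "is_fractional_material_integral \<alpha> b ?u v"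
    unfolding is_fractional_material_integral_def using u_conv v_conv v_transform by (auto intro!: exI[of _ \<sigma>])
  moreover have "(AE (x, t) in lebesgue. t \<ge> 0 \<longrightarrow> w x t = v x t) \<and>
      (continuous_on (UNIV \<times> {0..}) (\<lambda>(x, t). w x t) \<longrightarrow> (\<forall>x. \<forall>t\<ge>0. w x t = v x t))"
    if w: "is_fractional_material_integral \<alpha> b ?u w" for w
  proof -
    obtain \<sigma>\<^sub>1 where \<sigma>\<^sub>1: "fourier_laplace_converges w \<sigma>\<^sub>1"
      "\<And>\<xi> s. Re s > \<sigma>\<^sub>1 \<Longrightarrow> fourier_laplace w \<xi> s = (s - \<i> * of_real (b \<bullet> \<xi>)) powr (- of_real \<alpha>) * fourier_laplace ?u \<xi> s"
      using w unfolding is_fractional_material_integral_def by blast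
    have ae: "AE p in lebesgue. snd p \<ge> 0 \<longrightarrow> w (fst p) (snd p) = v (fst p) (snd p)"
    proof (rule fourier_laplace_inject_AE)
      show "fourier_laplace_converges v (max \<sigma> \<sigma>\<^sub>1)" "fourier_laplace_converges w (max \<sigma> \<sigma>\<^sub>1)"
        using v_conv \<sigma>\<^sub>1(1) by (auto intro: fourier_laplace_converges_mono)
      show "fourier_laplace w \<xi> s = fourier_laplace v \<xi> s" if "max \<sigma> \<sigma>\<^sub>1 < Re s" for \<xi> s
        using that by (simp add: \<sigma>\<^sub>1(2) v_transform)
    qed
    have "continuous_on UNIV (\<lambda>p. v (fst p) (snd p))"
      unfolding v_eq using V_cont Gamma by (auto intro!: continuous_intros)
    then have v_cont: "continuous_on (UNIV \<times> {0..}) (\<lambda>p. v (fst p) (snd p))"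
      by (rule continuous_on_subset) simp
    show ?thesis
      using ae continuous_eq_if_AE_eq[OF ae v_cont] by (auto simp: case_prod_unfold)
  qed
  ultimately show ?thesis
    unfolding Let_def v_def[abs_def] by blast
qed

end
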